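(* Let $n\geq 4$. For each $I\subseteq[n-1]$ with $I\neq\emptyset$ and each $i\in I$ set \[ r_{I,i}=|\{k : k\in I,\ k<i\}|+|\{k : k\in[n-1]\setminus I\}|. \] Then, for all $j\ge 0$, \[ \beta_j(L(C_n))=\sum_{\emptyset\neq I\subseteq[n-1]}\ \sum_{i\in I}\binom{r_{I,i}}{j}. \] In particular, $\beta_0(L(C_n))=(n-1)2^{n-2}$.
   Context: For $k\geq 3$, $C_k$ denotes the $k$-cycle with vertex set $[k]=\{1,\dots,k\}$ and edges $e_i=\{i,i+1\}$ for $i=1,\dots,k-1$ and $e_k=\{1,k\}$. For $A\subseteq[k]$ the cut monomial is $u_A=\alpha_1\cdots\alpha_k$, where $\alpha_i=s_i$ if exactly one of the two vertices of $e_i$ belongs to $A$, and $\alpha_i=t_i$ otherwise; the monomial cut ideal is $I(C_k)=\langle u_A: A\subseteq[k]\rangle$. All ideals are regarded as ideals of $S=K[s_1,\dots,s_n,t_1,\dots,t_n]$ over a field $K$. The ideal $I'(C_{n-1})$ is obtained from $I(C_{n-1})$ by exchanging $s_{n-1}$ and $t_{n-1}$ and keeping the other variables unchanged, and $L(C_n)=I(C_{n-1})\cap I'(C_{n-1})$. For a finitely generated graded $S$-module $M$, $\beta_j(M)=\dim_K\operatorname{Tor}_j^S(M,K)$ denotes its $j$th total Betti number. *)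

theory Defs
  imports
    "Jordan_Normal_Form.VS_Connect"
    "HOL-Algebra.Ideal"
    "HOL-Library.Poly_Mapping"
    "HOL-Combinatorics.Transposition"
begin

section \<open>Tor for modules with a resolution by free modules of finite rank\<close>

text \<open>
  The fields \<open>mult\<close> and \<open>one\<close> of a module record carry no meaning; they are filled with
  dummy values below.
\<close>

definition ideal_module :: "('a, 'm) ring_scheme \<Rightarrow> 'a set \<Rightarrow> ('a, 'a) module" where
  "ideal_module R J = \<lparr>carrier = J, mult = mult R, one = one R, zero = zero R,
     add = add R, smult = mult R\<rparr>"

definition power_module :: "('a, 'b, 'm) module_scheme \<Rightarrow> nat \<Rightarrow> ('a, nat \<Rightarrow> 'b) module" where
  "power_module N r = \<lparr>carrier = {..<r} \<rightarrow>\<^sub>E carrier N,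
     mult = (\<lambda>x y. \<lambda>i\<in>{..<r}. \<zero>\<^bsub>N\<^esub>), one = (\<lambda>i\<in>{..<r}. \<zero>\<^bsub>N\<^esub>),
     zero = (\<lambda>i\<in>{..<r}. \<zero>\<^bsub>N\<^esub>),
     add = (\<lambda>x y. \<lambda>i\<in>{..<r}. x i \<oplus>\<^bsub>N\<^esub> y i),
     smult = (\<lambda>a x. \<lambda>i\<in>{..<r}. a \<odot>\<^bsub>N\<^esub> x i)\<rparr>"

text \<open>
  For an \<open>m\<close> by \<open>n\<close> matrix \<open>A\<close> over \<open>R\<close> this is the map from \<open>N^n\<close> to \<open>N^m\<close> obtained by
  tensoring the map \<open>A\<close> from \<open>R^n\<close> to \<open>R^m\<close> with \<open>N\<close>; for \<open>N = R\<close> it is that map itself.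
\<close>

definition mat_map ::
  "('a, 'b, 'm) module_scheme \<Rightarrow> nat \<Rightarrow> nat \<Rightarrow> (nat \<Rightarrow> nat \<Rightarrow> 'a) \<Rightarrow> (nat \<Rightarrow> 'b) \<Rightarrow> nat \<Rightarrow> 'b" where
  "mat_map N m n A x = (\<lambda>i\<in>{..<m}. \<Oplus>\<^bsub>N\<^esub>k\<in>{..<n}. A i k \<odot>\<^bsub>N\<^esub> x k)"

text \<open>
  The complex \<open>\<dots> \<rightarrow> N^(r 2) \<rightarrow> N^(r 1) \<rightarrow> N^(r 0) \<rightarrow> 0\<close> in which the matrix \<open>d j\<close> gives the map
  from \<open>N^(r (j + 1))\<close> to \<open>N^(r j)\<close>.
\<close>

definition cycles ::
  "('a, 'b, 'm) module_scheme \<Rightarrow> (nat \<Rightarrow> nat) \<Rightarrow> (nat \<Rightarrow> nat \<Rightarrow> nat \<Rightarrow> 'a) \<Rightarrow> nat \<Rightarrow> (nat \<Rightarrow> 'b) set" where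
  "cycles N r d j = (case j of
       0 \<Rightarrow> carrier (power_module N (r 0))
     | Suc i \<Rightarrow> {x \<in> carrier (power_module N (r (Suc i))).
                  mat_map N (r i) (r (Suc i)) (d i) x = \<zero>\<^bsub>power_module N (r i)\<^esub>})"

definition boundaries ::
  "('a, 'b, 'm) module_scheme \<Rightarrow> (nat \<Rightarrow> nat) \<Rightarrow> (nat \<Rightarrow> nat \<Rightarrow> nat \<Rightarrow> 'a) \<Rightarrow> nat \<Rightarrow> (nat \<Rightarrow> 'b) set" where
  "boundaries N r d j =
     mat_map N (r j) (r (Suc j)) (d j) ` carrier (power_module N (r (Suc j)))"

text \<open>
  \<open>\<dots> \<rightarrow> R^(r 1) \<rightarrow> R^(r 0) \<rightarrow> M \<rightarrow> 0\<close> is exact, where the augmentation sends the \<open>k\<close>-th unit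
  vector of \<open>R^(r 0)\<close> to \<open>g k\<close>.
\<close>

definition free_resolution ::
  "('a, 'c) ring_scheme \<Rightarrow> ('a, 'b, 'm) module_scheme \<Rightarrow> (nat \<Rightarrow> nat) \<Rightarrow>
   (nat \<Rightarrow> nat \<Rightarrow> nat \<Rightarrow> 'a) \<Rightarrow> (nat \<Rightarrow> 'b) \<Rightarrow> bool" where
  "free_resolution R M r d g \<longleftrightarrow>
     (let F = ideal_module R (carrier R);
          aug = (\<lambda>x. \<Oplus>\<^bsub>M\<^esub>k\<in>{..<r 0}. x k \<odot>\<^bsub>M\<^esub> g k)
      in (\<forall>k<r 0. g k \<in> carrier M) \<and>
         (\<forall>j. \<forall>i<r j. \<forall>k<r (Suc j). d j i k \<in> carrier R) \<and>
         aug ` carrier (power_module F (r 0)) = carrier M \<and>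
         boundaries F r d 0 = {x \<in> carrier (power_module F (r 0)). aug x = \<zero>\<^bsub>M\<^esub>} \<and>
         (\<forall>j. boundaries F r d (Suc j) = cycles F r d (Suc j)))"

definition quotient_module ::
  "('a, 'b, 'm) module_scheme \<Rightarrow> 'b set \<Rightarrow> ('a, 'b set) module" where
  "quotient_module M B = \<lparr>carrier = a_rcosets\<^bsub>M\<^esub> B, mult = (\<lambda>C D. B), one = B, zero = B,
     add = set_add M, smult = (\<lambda>a C. \<Union>c\<in>C. B +>\<^bsub>M\<^esub> (a \<odot>\<^bsub>M\<^esub> c))\<rparr>"

definition homology ::
  "('a, 'b, 'm) module_scheme \<Rightarrow> (nat \<Rightarrow> nat) \<Rightarrow> (nat \<Rightarrow> nat \<Rightarrow> nat \<Rightarrow> 'a) \<Rightarrow> nat \<Rightarrow>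
   ('a, (nat \<Rightarrow> 'b) set) module" where
  "homology N r d j =
     quotient_module ((power_module N (r j))\<lparr>carrier := cycles N r d j\<rparr>) (boundaries N r d j)"

text \<open>
  \<open>Tor_j(M, N)\<close> is computed from a chosen resolution of \<open>M\<close>. The definition is meaningful only
  if \<open>M\<close> has a resolution by free modules of finite rank, which is the case for every finitely
  generated module over a Noetherian ring.
\<close>

definition Tor ::
  "('a, 'c) ring_scheme \<Rightarrow> ('a, 'b, 'm) module_scheme \<Rightarrow> ('a, 'e, 'l) module_scheme \<Rightarrow> nat \<Rightarrow>
   ('a, (nat \<Rightarrow> 'e) set) module" where
  "Tor R M N j = (case (SOME (r, d). \<exists>g. free_resolution R M r d g) of (r, d) \<Rightarrow> homology N r d j)"

definition restrict_scalars ::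
  "('k \<Rightarrow> 'a) \<Rightarrow> ('a, 'b, 'm) module_scheme \<Rightarrow> ('k, 'b) module" where
  "restrict_scalars f M = \<lparr>carrier = carrier M, mult = mult M, one = one M, zero = zero M,
     add = add M, smult = (\<lambda>c. smult M (f c))\<rparr>"


section \<open>Betti numbers over the polynomial ring in the cut variables\<close>

datatype cut_var = Sv nat | Tv nat

type_synonym 'k cut_poly = "(cut_var \<Rightarrow>\<^sub>0 nat) \<Rightarrow>\<^sub>0 'k"

definition poly_ring :: "nat \<Rightarrow> 'k::field cut_poly ring" where
  "poly_ring n = \<lparr>carrier = {p. \<forall>m\<in>Poly_Mapping.keys p. Poly_Mapping.keys m \<subseteq> Sv ` {1..n} \<union> Tv ` {1..n}},
     mult = (*), one = 1, zero = 0, add = (+)\<rparr>"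

definition pvar :: "cut_var \<Rightarrow> 'k::field cut_poly" where
  "pvar v = Poly_Mapping.single (Poly_Mapping.single v 1) 1"

definition pconst :: "'k::field \<Rightarrow> 'k cut_poly" where
  "pconst c = Poly_Mapping.single 0 c"

text \<open>
  The field \<open>K\<close> as the quotient of the polynomial ring by the ideal of all variables: a
  polynomial acts through its constant coefficient.
\<close>

definition residue_module :: "('k::field cut_poly, 'k) module" where
  "residue_module = \<lparr>carrier = UNIV, mult = (*), one = 1, zero = 0, add = (+),
     smult = (\<lambda>p c. Poly_Mapping.lookup p 0 * c)\<rparr>"

definition betti :: "nat \<Rightarrow> ('k::field cut_poly, 'b, 'm) module_scheme \<Rightarrow> nat \<Rightarrow> nat" where
  "betti n M j =
     vectorspace.dim class_ring (restrict_scalars pconst (Tor (poly_ring n) M residue_module j))"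


section \<open>Cut ideals of cycles\<close>

definition cycle_edge :: "nat \<Rightarrow> nat \<Rightarrow> nat set" where
  "cycle_edge k i = (if i < k then {i, i + 1} else {1, k})"

definition cut_monomial :: "nat \<Rightarrow> nat set \<Rightarrow> 'k::field cut_poly" where
  "cut_monomial k A =
     (\<Prod>i\<in>{1..k}. pvar (if card (cycle_edge k i \<inter> A) = 1 then Sv i else Tv i))"

definition cut_ideal :: "nat \<Rightarrow> nat \<Rightarrow> 'k::field cut_poly set" where
  "cut_ideal n k = Idl\<^bsub>poly_ring n\<^esub> {cut_monomial k A | A. A \<subseteq> {1..k}}"

text \<open>
  Since \<open>Transposition.transpose (Sv k) (Tv k)\<close> is an involution, \<open>map_key\<close> along it renames the variables of a
  monomial accordingly, and the outer \<open>map_key\<close> renames the monomials of a polynomial.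
\<close>

definition exchange :: "nat \<Rightarrow> 'k::field cut_poly \<Rightarrow> 'k cut_poly" where
  "exchange k = Poly_Mapping.map_key (Poly_Mapping.map_key (Transposition.transpose (Sv k) (Tv k)))"

definition cut_ideal' :: "nat \<Rightarrow> nat \<Rightarrow> 'k::field cut_poly set" where
  "cut_ideal' n k = exchange k ` cut_ideal n k"

definition L_ideal :: "nat \<Rightarrow> 'k::field cut_poly set" where
  "L_ideal n = cut_ideal n (n - 1) \<inter> cut_ideal' n (n - 1)"

definition r_num :: "nat \<Rightarrow> nat set \<Rightarrow> nat \<Rightarrow> nat" where
  "r_num n I i = card {k. k \<in> I \<and> k < i} + card {k. k \<in> {1..n - 1} - I}"

end

theory Submission
  imports Defs
begin

text \<open>
  Put \<open>m = n - 1\<close>. The edges of a cycle that are cut by a vertex set are exactly the sets of even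
  size, so \<open>I(C_m)\<close> is generated by the squarefree words \<open>\<alpha>_1 \<dots> \<alpha>_m\<close>, each \<open>\<alpha>_k\<close> being \<open>s_k\<close> or \<open>t_k\<close>,
  that contain an even number of letters \<open>s\<close>, and \<open>I'(C_m)\<close> by those with an odd number. A monomial
  in both ideals is divisible by an even and by an odd word; these differ at some place \<open>i\<close>, so the
  monomial is divisible by a word with the letter at \<open>i\<close> doubled to \<open>s_i t_i\<close>. Hence \<open>L(C_n)\<close> is the
  monomial ideal of these double words \<open>w(I, i)\<close>, one for each \<open>i \<in> I \<subseteq> [m]\<close>, where \<open>I\<close> is the set of
  places that carry an \<open>s\<close> (\<open>L_ideal_eq\<close>).

  List the double words by decreasing size of \<open>I\<close> and, for one \<open>I\<close>, by increasing \<open>i\<close>. The colon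
  ideal of the earlier words by \<open>w(I, i)\<close> is then generated by variables: the \<open>s_k\<close> with \<open>k \<notin> I\<close> and
  the \<open>t_k\<close> with \<open>k \<in> I\<close>, \<open>k < i\<close> (\<open>colon_double_word\<close>). Their number is \<open>r_{I,i}\<close>. Adding one
  generator \<open>f\<close> to an ideal \<open>J\<close> means taking the mapping cone of a lift of \<open>f : S/(J : f) \<rightarrow> S/J\<close> to
  resolutions, and the Koszul complex on \<open>r\<close> variables, which is itself obtained by adding one variable
  after another, has rank \<open>r choose j\<close> in degree \<open>j\<close>. As all double words have the same degree, the
  lifts can be chosen with linear entries, so the resolution that results has linear entries beyond
  the row of generators (\<open>double_words_resolution\<close>); in particular all of its matrices vanish modulo
  the variables.

  It remains to see that such a resolution computes \<open>Tor\<close>, which is defined through an arbitrary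
  resolution \<open>F\<close>. Comparison maps between \<open>F\<close> and the minimal resolution \<open>G\<close> are inverse to each other
  up to homotopy. Modulo the variables the homotopy on \<open>G\<close> disappears, so the homology of \<open>F\<close> modulo
  the variables is isomorphic to \<open>G\<close> modulo the variables (\<open>minimal_comparison\<close>,
  \<open>betti_of_minimal_resolution\<close>).
\<close>

section \<open>Resolutions by matrices over a subring\<close>

text \<open>
  The polynomial ring in the first variables is a subset of a type that has infinitely many variables,
  so vectors and matrices are those of the ambient ring with all entries in a given subset.
\<close>

definition vecs_in :: "'a set \<Rightarrow> nat \<Rightarrow> 'a vec set" where
  "vecs_in S n = {v \<in> carrier_vec n. \<forall>i<n. v $ i \<in> S}"

definition mats_in :: "'a set \<Rightarrow> nat \<Rightarrow> nat \<Rightarrow> 'a mat set" where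
  "mats_in S m n = {A \<in> carrier_mat m n. \<forall>i<m. \<forall>j<n. A $$ (i, j) \<in> S}"

text \<open>
  The resolved module is \<open>S/J\<close>, not \<open>J\<close>: position \<open>0\<close> of the complex is \<open>S\<close> itself and the generators
  of \<open>J\<close> form the row \<open>d 0\<close>. The augmentation thus becomes one more differential, and the constructions
  below need no separate first step.
\<close>

definition resolves ::
  "'a::comm_ring_1 set \<Rightarrow> (nat \<Rightarrow> nat) \<Rightarrow> (nat \<Rightarrow> 'a mat) \<Rightarrow> 'a set \<Rightarrow> bool" where
  "resolves S r d J \<longleftrightarrow> r 0 = 1 \<and>
     (\<forall>j. d j \<in> mats_in S (r j) (r (Suc j))) \<and>
     (\<forall>j. d j * d (Suc j) = 0\<^sub>m (r j) (r (Suc (Suc j)))) \<and>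
     (\<forall>j. \<forall>x\<in>vecs_in S (r (Suc j)). d j *\<^sub>v x = 0\<^sub>v (r j) \<longrightarrow>
        (\<exists>y\<in>vecs_in S (r (Suc (Suc j))). d (Suc j) *\<^sub>v y = x)) \<and>
     J = {(d 0 *\<^sub>v x) $ 0 | x. x \<in> vecs_in S (r 1)}"

lemma mats_in_carrier: "A \<in> mats_in S m n \<Longrightarrow> A \<in> carrier_mat m n"
  by (simp add: mats_in_def)

lemma vecs_in_carrier: "v \<in> vecs_in S n \<Longrightarrow> v \<in> carrier_vec n"
  by (simp add: vecs_in_def)

lemma col_mats_in: "A \<in> mats_in S m n \<Longrightarrow> j < n \<Longrightarrow> col A j \<in> vecs_in S m"
  by (auto simp: mats_in_def vecs_in_def)

lemma mult_unit_vec: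
  "A \<in> carrier_mat m n \<Longrightarrow> i < n \<Longrightarrow> A *\<^sub>v unit_vec n i = col A i" for A :: "'a::comm_ring_1 mat"
  by (intro eq_vecI) auto

lemma resolves_image: "resolves S r d J \<Longrightarrow> x \<in> vecs_in S (r 1) \<Longrightarrow> (d 0 *\<^sub>v x) $ 0 \<in> J"
  unfolding resolves_def by blast

lemma resolves_exact:
  "resolves S r d J \<Longrightarrow> x \<in> vecs_in S (r (Suc j)) \<Longrightarrow> d j *\<^sub>v x = 0\<^sub>v (r j) \<Longrightarrow>
    \<exists>y\<in>vecs_in S (r (Suc (Suc j))). d (Suc j) *\<^sub>v y = x"
  by (simp add: resolves_def)

locale subring_set =
  fixes S :: "'a::comm_ring_1 set"
  assumes zero_closed: "0 \<in> S" and one_closed: "1 \<in> S"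
    and add_closed: "\<And>a b. a \<in> S \<Longrightarrow> b \<in> S \<Longrightarrow> a + b \<in> S"
    and mult_closed: "\<And>a b. a \<in> S \<Longrightarrow> b \<in> S \<Longrightarrow> a * b \<in> S"
    and uminus_closed: "\<And>a. a \<in> S \<Longrightarrow> - a \<in> S"
begin

lemma sum_closed: "(\<And>i. i \<in> I \<Longrightarrow> f i \<in> S) \<Longrightarrow> sum f I \<in> S"
  by (induction I rule: infinite_finite_induct) (auto simp: zero_closed add_closed)

lemma mult_vec_in: "A \<in> mats_in S m n \<Longrightarrow> v \<in> vecs_in S n \<Longrightarrow> A *\<^sub>v v \<in> vecs_in S m"
  by (auto simp: mats_in_def vecs_in_def scalar_prod_def intro!: sum_closed mult_closed)

lemma mult_mats_in: "A \<in> mats_in S m n \<Longrightarrow> B \<in> mats_in S n k \<Longrightarrow> A * B \<in> mats_in S m k"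
  by (auto simp: mats_in_def scalar_prod_def intro!: sum_closed mult_closed)

lemma uminus_mats_in: "A \<in> mats_in S m n \<Longrightarrow> - A \<in> mats_in S m n"
  by (auto simp: mats_in_def uminus_closed)

lemma minus_closed: "a \<in> S \<Longrightarrow> b \<in> S \<Longrightarrow> a - b \<in> S"
  using add_closed uminus_closed by fastforce

lemma minus_mats_in: "A \<in> mats_in S m n \<Longrightarrow> B \<in> mats_in S m n \<Longrightarrow> A - B \<in> mats_in S m n"
  by (auto simp: mats_in_def minus_closed)

lemma zero_mats_in: "0\<^sub>m m n \<in> mats_in S m n"
  by (auto simp: mats_in_def zero_closed)

lemma one_mats_in: "1\<^sub>m n \<in> mats_in S n n"
  by (auto simp: mats_in_def zero_closed one_closed)

lemma unit_vec_in: "unit_vec n i \<in> vecs_in S n"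
  by (auto simp: vecs_in_def unit_vec_def zero_closed one_closed)

lemma lift_columns:
  assumes A: "A \<in> mats_in S m n" and X: "X \<in> mats_in S m k"
    and lift: "\<And>j. j < k \<Longrightarrow> \<exists>y\<in>vecs_in S n. A *\<^sub>v y = col X j"
  shows "\<exists>Y\<in>mats_in S n k. A * Y = X"
proof -
  obtain y where y: "\<And>j. j < k \<Longrightarrow> y j \<in> vecs_in S n" "\<And>j. j < k \<Longrightarrow> A *\<^sub>v y j = col X j"
    using lift by metis
  define Y where "Y = mat n k (\<lambda>(i, j). y j $ i)"
  have colY: "col Y j = y j" if "j < k" for j
    using y(1)[OF that] that by (auto simp: Y_def vecs_in_def)
  have Y: "Y \<in> mats_in S n k"
    using y(1) by (auto simp: Y_def mats_in_def vecs_in_def)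
  have "A * Y = X"
  proof (rule mat_col_eqI)
    fix j assume "j < dim_col X"
    then have j: "j < k" using X by (auto simp: mats_in_def)
    have "col (A * Y) j = A *\<^sub>v col Y j"
      by (rule col_mult2[OF mats_in_carrier[OF A] mats_in_carrier[OF Y] j])
    then show "col (A * Y) j = col X j" using colY[OF j] y(2)[OF j] by simp
  qed (use A X Y in \<open>auto simp: mats_in_def\<close>)
  with Y show ?thesis by blast
qed

lemma resolves_d:
  assumes "resolves S r d J" shows "d j \<in> mats_in S (r j) (r (Suc j))"
  using assms by (simp add: resolves_def)

lemma resolves_generator:
  assumes res: "resolves S r d J" and i: "i < r 1" shows "d 0 $$ (0, i) \<in> J"
proof -
  have d0: "d 0 \<in> carrier_mat 1 (r 1)"
    using mats_in_carrier[OF resolves_d[OF res, of 0]] res by (simp add: resolves_def)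
  have "d 0 *\<^sub>v unit_vec (r 1) i = col (d 0) i" by (rule mult_unit_vec[OF d0 i])
  then show ?thesis using resolves_image[OF res unit_vec_in, of i] d0 i by simp
qed

lemma lift_cycles:
  assumes res: "resolves S r d J" and X: "X \<in> mats_in S (r (Suc j)) k"
    and cyc: "d j * X = 0\<^sub>m (r j) k"
  shows "\<exists>Y\<in>mats_in S (r (Suc (Suc j))) k. d (Suc j) * Y = X"
proof (rule lift_columns[OF resolves_d[OF res] X])
  fix i assume i: "i < k"
  have "d j *\<^sub>v col X i = col (d j * X) i"
    by (rule col_mult2[symmetric, OF mats_in_carrier[OF resolves_d[OF res]] mats_in_carrier[OF X] i])
  also have "\<dots> = 0\<^sub>v (r j)" using i by (simp add: cyc)
  finally show "\<exists>y\<in>vecs_in S (r (Suc (Suc j))). d (Suc j) *\<^sub>v y = col X i"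
    using res col_mats_in[OF X i] by (simp add: resolves_def)
qed

lemma lift_ideal:
  assumes res: "resolves S r d J" and X: "X \<in> mats_in S 1 k"
    and J: "\<And>i. i < k \<Longrightarrow> X $$ (0, i) \<in> J"
  shows "\<exists>Y\<in>mats_in S (r 1) k. d 0 * Y = X"
proof -
  have r0: "r 0 = 1" and d0: "d 0 \<in> mats_in S 1 (r 1)"
    using res resolves_d[OF res, of 0] by (auto simp: resolves_def)
  show ?thesis
  proof (rule lift_columns[OF d0 X])
    fix i assume i: "i < k"
    then obtain x where x: "x \<in> vecs_in S (r 1)" "X $$ (0, i) = (d 0 *\<^sub>v x) $ 0"
      using J[OF i] res by (auto simp: resolves_def)
    have "d 0 *\<^sub>v x = col X i"
      using x d0 X i by (intro eq_vecI) (auto simp: mats_in_def)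
    with x show "\<exists>y\<in>vecs_in S (r 1). d 0 *\<^sub>v y = col X i" by blast
  qed
qed

section \<open>Comparison of resolutions\<close>

text \<open>
  The usual degreewise lifting. The predicate \<open>T\<close> is a property that every lift can be given, once the
  previous one has it; it serves both for arbitrary chain maps and for those with linear entries.
\<close>

lemma chain_map_exists:
  assumes P: "resolves S p dP I" and Q: "resolves S q dQ J"
    and \<phi>0: "\<phi>0 \<in> mats_in S 1 1"
    and start: "\<exists>Y\<in>mats_in S (q 1) (p 1). T Y \<and> dQ 0 * Y = \<phi>0 * dP 0"
    and step: "\<And>j Y Z. Y \<in> mats_in S (q (Suc j)) (p (Suc j)) \<Longrightarrow> T Y \<Longrightarrow>
      Z \<in> mats_in S (q (Suc (Suc j))) (p (Suc (Suc j))) \<Longrightarrow> dQ (Suc j) * Z = Y * dP (Suc j) \<Longrightarrow>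
      \<exists>Z'\<in>mats_in S (q (Suc (Suc j))) (p (Suc (Suc j))). T Z' \<and> dQ (Suc j) * Z' = Y * dP (Suc j)"
  shows "\<exists>\<phi>. \<phi> 0 = \<phi>0 \<and> (\<forall>j. \<phi> j \<in> mats_in S (q j) (p j) \<and> T (\<phi> (Suc j)) \<and>
    dQ j * \<phi> (Suc j) = \<phi> j * dP j)"
proof -
  have r0: "p 0 = 1" "q 0 = 1" using P Q by (auto simp: resolves_def)
  \<comment> \<open>The next lift is part of the invariant, since its existence depends on the lift before.\<close>
  define R where "R n f \<longleftrightarrow> f \<in> mats_in S (q n) (p n) \<and> (n = 0 \<longrightarrow> f = \<phi>0) \<and>
    (\<exists>Y\<in>mats_in S (q (Suc n)) (p (Suc n)). T Y \<and> dQ n * Y = f * dP n)" for n f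
  have "R 0 \<phi>0" using \<phi>0 start by (simp add: R_def r0)
  moreover have "\<exists>g. R (Suc n) g \<and> T g \<and> dQ n * g = f * dP n" if f: "R n f" for n f
  proof -
    obtain Y where Y: "Y \<in> mats_in S (q (Suc n)) (p (Suc n))" "T Y" "dQ n * Y = f * dP n"
      using f by (auto simp: R_def)
    note c = mats_in_carrier[OF Y(1)] mats_in_carrier[OF resolves_d[OF P]]
      mats_in_carrier[OF resolves_d[OF Q]]
    have fc: "f \<in> carrier_mat (q n) (p n)" using f by (auto simp: R_def mats_in_carrier)
    have "dQ n * (Y * dP (Suc n)) = f * (dP n * dP (Suc n))"
      using Y(3) assoc_mult_mat[OF c(3) c(1) c(2)] assoc_mult_mat[OF fc c(2) c(2)] by simp
    also have "\<dots> = 0\<^sub>m (q n) (p (Suc (Suc n)))"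
      using P fc by (simp add: resolves_def)
    finally obtain Z where "Z \<in> mats_in S (q (Suc (Suc n))) (p (Suc (Suc n)))"
        "dQ (Suc n) * Z = Y * dP (Suc n)"
      using lift_cycles[OF Q mult_mats_in[OF Y(1) resolves_d[OF P]]] by blast
    from step[OF Y(1,2) this] Y show ?thesis by (auto simp: R_def)
  qed
  ultimately obtain \<phi> where "\<And>n. R n (\<phi> n)"
      "\<And>n. T (\<phi> (Suc n)) \<and> dQ n * \<phi> (Suc n) = \<phi> n * dP n"
    using dependent_nat_choice[of R "\<lambda>n f g. T g \<and> dQ n * g = f * dP n"] by metis
  then show ?thesis by (metis R_def)
qed

lemma comparison_map:
  assumes P: "resolves S p dP J" and Q: "resolves S q dQ J"
  shows "\<exists>\<phi>. \<phi> 0 = 1\<^sub>m 1 \<and> (\<forall>j. \<phi> j \<in> mats_in S (q j) (p j) \<and> dQ j * \<phi> (Suc j) = \<phi> j * dP j)"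
proof -
  have p0: "p 0 = 1" and d0: "dP 0 \<in> mats_in S 1 (p 1)"
    using P resolves_d[OF P, of 0] by (auto simp: resolves_def)
  from lift_ideal[OF Q d0 resolves_generator[OF P]]
  have "\<exists>Y\<in>mats_in S (q 1) (p 1). True \<and> dQ 0 * Y = 1\<^sub>m 1 * dP 0"
    using left_mult_one_mat[OF mats_in_carrier[OF d0]] by simp
  from chain_map_exists[OF P Q one_mats_in this] show ?thesis by blast
qed

text \<open>
  A chain map that is zero in degree \<open>0\<close> lifts the zero map; the homotopy starts with \<open>0\<close> and
  \<open>\<delta> (n + 1) - h n dP n\<close> is a cycle, which lifts to \<open>h (n + 1)\<close>.
\<close>

lemma null_homotopy:
  assumes P: "resolves S p dP I" and Q: "resolves S q dQ J"
    and \<delta>: "\<And>j. \<delta> j \<in> mats_in S (q j) (p j)" "\<And>j. dQ j * \<delta> (Suc j) = \<delta> j * dP j"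
    and \<delta>0: "\<delta> 0 = 0\<^sub>m 1 1"
  shows "\<exists>h. \<forall>j. h j \<in> mats_in S (q (Suc j)) (p j) \<and>
    \<delta> (Suc j) = dQ (Suc j) * h (Suc j) + h j * dP j"
proof -
  have r0: "p 0 = 1" "q 0 = 1" using P Q by (auto simp: resolves_def)
  note dc = mats_in_carrier[OF resolves_d[OF P]] mats_in_carrier[OF resolves_d[OF Q]]
    mats_in_carrier[OF \<delta>(1)]
  have minus_zero: "M - 0\<^sub>m a b = M" if "M \<in> carrier_mat a b" for M :: "'a mat" and a b
    using that by (intro eq_matI) auto
  define R where "R n h \<longleftrightarrow> h \<in> mats_in S (q (Suc n)) (p n) \<and>
    dQ n * (\<delta> (Suc n) - h * dP n) = 0\<^sub>m (q n) (p (Suc n))" for n h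
  have "R 0 (0\<^sub>m (q 1) (p 0))"
  proof -
    have "\<delta> 1 - 0\<^sub>m (q 1) (p 0) * dP 0 = \<delta> 1"
      using dc(1)[of 0] dc(3)[of 1] by (intro eq_matI) auto
    moreover have "dQ 0 * \<delta> 1 = 0\<^sub>m (q 0) (p 1)"
      using \<delta>(2)[of 0] \<delta>0 dc(1)[of 0] r0 by simp
    ultimately show ?thesis by (simp add: R_def zero_mats_in)
  qed
  moreover have "\<exists>g. R (Suc n) g \<and> dQ (Suc n) * g = \<delta> (Suc n) - h * dP n" if h: "R n h" for n h
  proof -
    have hS: "h \<in> mats_in S (q (Suc n)) (p n)" using h by (simp add: R_def)
    have XS: "\<delta> (Suc n) - h * dP n \<in> mats_in S (q (Suc n)) (p (Suc n))"
      by (intro minus_mats_in \<delta> mult_mats_in[OF hS] resolves_d[OF P])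
    then obtain Y where Y: "Y \<in> mats_in S (q (Suc (Suc n))) (p (Suc n))"
        "dQ (Suc n) * Y = \<delta> (Suc n) - h * dP n"
      using lift_cycles[OF Q XS] h unfolding R_def by blast
    note yc = mats_in_carrier[OF Y(1)] mats_in_carrier[OF hS]
    have "dQ (Suc n) * (\<delta> (Suc (Suc n)) - Y * dP (Suc n))
        = dQ (Suc n) * \<delta> (Suc (Suc n)) - dQ (Suc n) * (Y * dP (Suc n))"
      by (rule mult_minus_distrib_mat[OF dc(2) dc(3)]) (use yc dc in auto)
    also have "dQ (Suc n) * (Y * dP (Suc n)) = (\<delta> (Suc n) - h * dP n) * dP (Suc n)"
      using assoc_mult_mat[OF dc(2) yc(1) dc(1)] Y(2) by simp
    also have "\<dots> = \<delta> (Suc n) * dP (Suc n) - h * dP n * dP (Suc n)"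
      by (rule minus_mult_distrib_mat[OF dc(3) _ dc(1)]) (use yc dc in auto)
    also have "h * dP n * dP (Suc n) = 0\<^sub>m (q (Suc n)) (p (Suc (Suc n)))"
      using assoc_mult_mat[OF yc(2) dc(1) dc(1)] P yc(2) by (simp add: resolves_def)
    also have "\<delta> (Suc n) * dP (Suc n) - 0\<^sub>m (q (Suc n)) (p (Suc (Suc n))) = \<delta> (Suc n) * dP (Suc n)"
      by (rule minus_zero[OF mult_carrier_mat[OF dc(3) dc(1)]])
    also have "dQ (Suc n) * \<delta> (Suc (Suc n)) - \<delta> (Suc n) * dP (Suc n) = 0\<^sub>m (q (Suc n)) (p (Suc (Suc n)))"
      unfolding \<delta>(2) using mult_carrier_mat[OF dc(3) dc(1), of "Suc n"] by (intro eq_matI) auto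
    finally show ?thesis using Y by (auto simp: R_def)
  qed
  ultimately obtain h where h: "\<And>n. R n (h n)"
      "\<And>n. dQ (Suc n) * h (Suc n) = \<delta> (Suc n) - h n * dP n"
    using dependent_nat_choice[of R "\<lambda>n h g. dQ (Suc n) * g = \<delta> (Suc n) - h * dP n"] by metis
  have "\<delta> (Suc j) = dQ (Suc j) * h (Suc j) + h j * dP j" for j
    unfolding h(2) using dc[of "Suc j"] dc(1)[of j] h(1)[of j]
    by (intro eq_matI) (auto simp: R_def mats_in_def)
  with h(1) show ?thesis by (auto simp: R_def)
qed

lemma comparison_homotopy:
  assumes P: "resolves S p dP J" and Q: "resolves S q dQ J"
    and \<phi>: "\<phi> 0 = 1\<^sub>m 1" "\<And>j. \<phi> j \<in> mats_in S (q j) (p j)" "\<And>j. dQ j * \<phi> (Suc j) = \<phi> j * dP j"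
    and \<psi>: "\<psi> 0 = 1\<^sub>m 1" "\<And>j. \<psi> j \<in> mats_in S (p j) (q j)" "\<And>j. dP j * \<psi> (Suc j) = \<psi> j * dQ j"
  shows "\<exists>h. \<forall>j. h j \<in> mats_in S (p (Suc j)) (p j) \<and>
    \<psi> (Suc j) * \<phi> (Suc j) - 1\<^sub>m (p (Suc j)) = dP (Suc j) * h (Suc j) + h j * dP j"
proof -
  define \<delta> where "\<delta> j = \<psi> j * \<phi> j - 1\<^sub>m (p j)" for j
  note dc = mats_in_carrier[OF resolves_d[OF P]] mats_in_carrier[OF resolves_d[OF Q]]
    mats_in_carrier[OF \<phi>(2)] mats_in_carrier[OF \<psi>(2)]
  have p0: "p 0 = 1" using P by (simp add: resolves_def)
  have "dP j * \<delta> (Suc j) = \<delta> j * dP j" for j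
  proof -
    have "dP j * \<delta> (Suc j) = dP j * (\<psi> (Suc j) * \<phi> (Suc j)) - dP j * 1\<^sub>m (p (Suc j))"
      unfolding \<delta>_def by (rule mult_minus_distrib_mat[OF dc(1)]) (use mult_carrier_mat[OF dc(4) dc(3)] in auto)
    also have "dP j * (\<psi> (Suc j) * \<phi> (Suc j)) = \<psi> j * dQ j * \<phi> (Suc j)"
      using assoc_mult_mat[OF dc(1) dc(4) dc(3)] \<psi>(3) by simp
    also have "\<dots> = \<psi> j * \<phi> j * dP j"
      using assoc_mult_mat[OF dc(4) dc(2) dc(3)] assoc_mult_mat[OF dc(4) dc(3) dc(1)] \<phi>(3) by simp
    also have "dP j * 1\<^sub>m (p (Suc j)) = 1\<^sub>m (p j) * dP j" using dc(1)[of j] by simp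
    also have "\<psi> j * \<phi> j * dP j - 1\<^sub>m (p j) * dP j = \<delta> j * dP j"
      unfolding \<delta>_def by (rule minus_mult_distrib_mat[symmetric, OF mult_carrier_mat[OF dc(4) dc(3)] one_carrier_mat dc(1)])
    finally show ?thesis .
  qed
  moreover have "\<delta> j \<in> mats_in S (p j) (p j)" for j
    unfolding \<delta>_def by (intro minus_mats_in mult_mats_in[OF \<psi>(2) \<phi>(2)] one_mats_in)
  moreover have "\<delta> 0 = 0\<^sub>m 1 1" by (simp add: \<delta>_def \<phi>(1) \<psi>(1) p0)
  ultimately show ?thesis using null_homotopy[OF P P, of \<delta>] by (simp add: \<delta>_def)
qed

end

text \<open>
  Two resolutions of the same ideal have comparison maps whose composites are homotopic to the
  identity. If \<open>\<epsilon>\<close> kills the differentials of \<open>G\<close>, the homotopy \<open>\<Phi> \<Psi> - 1 = d h + h d\<close> on \<open>G\<close> becomes zero,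
  whereas on \<open>F\<close> the term \<open>h d\<close> vanishes on cycles. So \<open>\<Psi>\<close> embeds the free module of rank
  \<open>g (Suc j)\<close> as a complement of the boundaries in the cycles of \<open>F\<close>.
\<close>

lemma minimal_comparison:
  fixes \<epsilon> :: "'a::comm_ring_1 \<Rightarrow> 'k::comm_ring_1"
  assumes "subring_set S" and hom: "comm_ring_hom \<epsilon>"
    and F: "resolves S f dF J" and G: "resolves S g dG J"
    and min: "\<And>j. map_mat \<epsilon> (dG j) = 0\<^sub>m (g j) (g (Suc j))"
  shows "\<exists>\<Phi> \<Psi> H. \<Phi> \<in> carrier_mat (g (Suc j)) (f (Suc j)) \<and> \<Psi> \<in> carrier_mat (f (Suc j)) (g (Suc j)) \<and>
     H \<in> carrier_mat (f (Suc (Suc j))) (f (Suc j)) \<and>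
     \<Phi> * \<Psi> = 1\<^sub>m (g (Suc j)) \<and> map_mat \<epsilon> (dF j) * \<Psi> = 0\<^sub>m (f j) (g (Suc j)) \<and>
     \<Phi> * map_mat \<epsilon> (dF (Suc j)) = 0\<^sub>m (g (Suc j)) (f (Suc (Suc j))) \<and>
     (\<forall>z\<in>carrier_vec (f (Suc j)). map_mat \<epsilon> (dF j) *\<^sub>v z = 0\<^sub>v (f j) \<longrightarrow>
        \<Psi> *\<^sub>v (\<Phi> *\<^sub>v z) = z + map_mat \<epsilon> (dF (Suc j)) *\<^sub>v (H *\<^sub>v z))"
proof -
  interpret subring_set S by fact
  interpret comm_ring_hom \<epsilon> by fact
  obtain \<phi> where \<phi>: "\<phi> 0 = 1\<^sub>m 1" "\<And>j. \<phi> j \<in> mats_in S (g j) (f j)"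
      "\<And>j. dG j * \<phi> (Suc j) = \<phi> j * dF j"
    using comparison_map[OF F G] by blast
  obtain \<psi> where \<psi>: "\<psi> 0 = 1\<^sub>m 1" "\<And>j. \<psi> j \<in> mats_in S (f j) (g j)"
      "\<And>j. dF j * \<psi> (Suc j) = \<psi> j * dG j"
    using comparison_map[OF G F] by blast
  obtain h where h: "\<And>j. h j \<in> mats_in S (f (Suc j)) (f j)"
      "\<And>j. \<psi> (Suc j) * \<phi> (Suc j) - 1\<^sub>m (f (Suc j)) = dF (Suc j) * h (Suc j) + h j * dF j"
    using comparison_homotopy[OF F G \<phi> \<psi>] by blast
  obtain k where k: "\<And>j. k j \<in> mats_in S (g (Suc j)) (g j)"
      "\<And>j. \<phi> (Suc j) * \<psi> (Suc j) - 1\<^sub>m (g (Suc j)) = dG (Suc j) * k (Suc j) + k j * dG j"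
    using comparison_homotopy[OF G F \<psi> \<phi>] by blast
  note c = mats_in_carrier[OF resolves_d[OF F]] mats_in_carrier[OF resolves_d[OF G]]
    mats_in_carrier[OF \<phi>(2)] mats_in_carrier[OF \<psi>(2)] mats_in_carrier[OF h(1)] mats_in_carrier[OF k(1)]
  let ?b = "map_mat \<epsilon>"
  define \<Phi> \<Psi> H where "\<Phi> = ?b (\<phi> (Suc j))" and "\<Psi> = ?b (\<psi> (Suc j))" and "H = ?b (h (Suc j))"
  have bc: "\<Phi> \<in> carrier_mat (g (Suc j)) (f (Suc j))" "\<Psi> \<in> carrier_mat (f (Suc j)) (g (Suc j))"
    "H \<in> carrier_mat (f (Suc (Suc j))) (f (Suc j))"
    using c by (auto simp: \<Phi>_def \<Psi>_def H_def)
  note hm = mat_hom_mult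
  have dm: "?b (A - B) = ?b A - ?b B" if "A \<in> carrier_mat m n" "B \<in> carrier_mat m n" for A B m n
    using that by (intro eq_matI) (auto simp: hom_minus)
  have am: "?b (A + B) = ?b A + ?b B" if "A \<in> carrier_mat m n" "B \<in> carrier_mat m n" for A B m n
    using that by (intro eq_matI) (auto simp: hom_add)
  have "\<Phi> * \<Psi> - 1\<^sub>m (g (Suc j)) = ?b (\<phi> (Suc j) * \<psi> (Suc j) - 1\<^sub>m (g (Suc j)))"
    using dm[of "\<phi> (Suc j) * \<psi> (Suc j)" "g (Suc j)" "g (Suc j)" "1\<^sub>m (g (Suc j))"] mult_carrier_mat[OF c(3) c(4), of "Suc j"]
      hm[OF c(3) c(4), of "Suc j"] by (simp add: \<Phi>_def \<Psi>_def mat_hom_one)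
  also have "\<dots> = ?b (dG (Suc j)) * ?b (k (Suc j)) + ?b (k j) * ?b (dG j)"
    unfolding k(2) using hm[OF c(2) c(6), of "Suc j"] hm[OF c(6) c(2), of j]
    by (simp add: am[OF mult_carrier_mat[OF c(2) c(6)] mult_carrier_mat[OF c(6) c(2)]])
  also have "\<dots> = 0\<^sub>m (g (Suc j)) (g (Suc j))" 
    using c(6)[of "Suc j"] c(6)[of j] by (simp add: min)
  finally have A: "\<Phi> * \<Psi> - 1\<^sub>m (g (Suc j)) = 0\<^sub>m (g (Suc j)) (g (Suc j))" .
  have 1: "\<Phi> * \<Psi> = 1\<^sub>m (g (Suc j))"
  proof (rule eq_matI)
    fix i l assume il: "i < dim_row (1\<^sub>m (g (Suc j)) :: 'k mat)" "l < dim_col (1\<^sub>m (g (Suc j)) :: 'k mat)"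
    have "(\<Phi> * \<Psi> - 1\<^sub>m (g (Suc j))) $$ (i, l) = 0" unfolding A using il by simp
    then show "(\<Phi> * \<Psi>) $$ (i, l) = 1\<^sub>m (g (Suc j)) $$ (i, l)" using il bc by simp
  qed (use bc in auto)
  have 2: "?b (dF j) * \<Psi> = 0\<^sub>m (f j) (g (Suc j))"
    using hm[OF c(1) c(4), of j] hm[OF c(4) c(2), of j] c(4)[of j] \<psi>(3)[of j]
    by (simp add: \<Psi>_def min)
  have 3: "\<Phi> * ?b (dF (Suc j)) = 0\<^sub>m (g (Suc j)) (f (Suc (Suc j)))"
    using hm[OF c(2) c(3), of "Suc j"] hm[OF c(3) c(1), of "Suc j"] c(3)[of "Suc (Suc j)"] \<phi>(3)[of "Suc j"]
    by (simp add: \<Phi>_def min)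
  have B: "\<Psi> * \<Phi> - 1\<^sub>m (f (Suc j)) = ?b (dF (Suc j)) * H + ?b (h j) * ?b (dF j)"
  proof -
    have "\<Psi> * \<Phi> - 1\<^sub>m (f (Suc j)) = ?b (\<psi> (Suc j) * \<phi> (Suc j) - 1\<^sub>m (f (Suc j)))"
      using dm[of "\<psi> (Suc j) * \<phi> (Suc j)" "f (Suc j)" "f (Suc j)" "1\<^sub>m (f (Suc j))"] mult_carrier_mat[OF c(4) c(3), of "Suc j"]
        hm[OF c(4) c(3), of "Suc j"] by (simp add: \<Phi>_def \<Psi>_def mat_hom_one)
    also have "\<dots> = ?b (dF (Suc j)) * H + ?b (h j) * ?b (dF j)"
      unfolding h(2) H_def using hm[OF c(1) c(5), of "Suc j"] hm[OF c(5) c(1), of j]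
      by (simp add: am[OF mult_carrier_mat[OF c(1) c(5)] mult_carrier_mat[OF c(5) c(1)]])
    finally show ?thesis .
  qed
  have 4: "\<Psi> *\<^sub>v (\<Phi> *\<^sub>v z) = z + ?b (dF (Suc j)) *\<^sub>v (H *\<^sub>v z)"
    if z: "z \<in> carrier_vec (f (Suc j))" and cyc: "?b (dF j) *\<^sub>v z = 0\<^sub>v (f j)" for z
  proof -
    have bd: "?b (dF i) \<in> carrier_mat (f i) (f (Suc i))" "?b (h i) \<in> carrier_mat (f (Suc i)) (f i)" for i
      using c by auto
    have "(\<Psi> * \<Phi> - 1\<^sub>m (f (Suc j))) *\<^sub>v z = \<Psi> *\<^sub>v (\<Phi> *\<^sub>v z) - z"
      using bc z by (subst minus_mult_distrib_mat_vec[of _ "f (Suc j)" "f (Suc j)"]) (auto intro: assoc_mult_mat_vec)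
    moreover have "(?b (dF (Suc j)) * H + ?b (h j) * ?b (dF j)) *\<^sub>v z
        = ?b (dF (Suc j)) *\<^sub>v (H *\<^sub>v z) + ?b (h j) *\<^sub>v (?b (dF j) *\<^sub>v z)"
      by (simp add: add_mult_distrib_mat_vec[OF mult_carrier_mat[OF bd(1) bc(3)] mult_carrier_mat[OF bd(2) bd(1)] z]
        assoc_mult_mat_vec[OF bd(1) bc(3) z] assoc_mult_mat_vec[OF bd(2) bd(1) z])
    moreover have "?b (h j) *\<^sub>v (0\<^sub>v (f j)) = 0\<^sub>v (f (Suc j))" using bd(2)[of j] by auto
    ultimately have e: "\<Psi> *\<^sub>v (\<Phi> *\<^sub>v z) - z = ?b (dF (Suc j)) *\<^sub>v (H *\<^sub>v z)"
      using B cyc right_zero_vec[OF mult_mat_vec_carrier[OF bd(1) mult_mat_vec_carrier[OF bc(3) z]]]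
      by simp
    have "\<Psi> *\<^sub>v (\<Phi> *\<^sub>v z) = z + (\<Psi> *\<^sub>v (\<Phi> *\<^sub>v z) - z)"
      using bc z by (intro eq_vecI) auto
    then show ?thesis by (simp add: e)
  qed
  show ?thesis
    using bc 1 2 3 4 by blast
qed

section \<open>Mapping cones\<close>

definition cone_rank :: "(nat \<Rightarrow> nat) \<Rightarrow> (nat \<Rightarrow> nat) \<Rightarrow> nat \<Rightarrow> nat" where
  "cone_rank p q j = p j + (case j of 0 \<Rightarrow> 0 | Suc i \<Rightarrow> q i)"

text \<open>
  The block matrix with rows \<open>(dP, \<theta>)\<close> and \<open>(0, -dQ)\<close>; the complex of \<open>Q\<close> is shifted by one and is
  empty in degree \<open>0\<close>.
\<close>

definition cone_diff ::
  "(nat \<Rightarrow> nat) \<Rightarrow> (nat \<Rightarrow> nat) \<Rightarrow> (nat \<Rightarrow> 'a::comm_ring_1 mat) \<Rightarrow> (nat \<Rightarrow> 'a mat) \<Rightarrow> (nat \<Rightarrow> 'a mat) \<Rightarrow>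
   nat \<Rightarrow> 'a mat" where
  "cone_diff p q dP dQ \<theta> j =
     four_block_mat (dP j) (\<theta> j) (0\<^sub>m (case j of 0 \<Rightarrow> 0 | Suc i \<Rightarrow> q i) (p (Suc j)))
       (case j of 0 \<Rightarrow> 0\<^sub>m 0 (q 0) | Suc i \<Rightarrow> - dQ i)"

lemma elements_cone_diff:
  assumes "dP j \<in> carrier_mat (p j) (p (Suc j))" "\<theta> j \<in> carrier_mat (p j) (q j)"
    "\<And>i. dQ i \<in> carrier_mat (q i) (q (Suc i))"
    and i: "i < cone_rank p q j" "k < cone_rank p q (Suc j)"
    and dP: "\<And>i k. i < p j \<Longrightarrow> k < p (Suc j) \<Longrightarrow> T (dP j $$ (i, k))"
    and th: "\<And>i k. i < p j \<Longrightarrow> k < q j \<Longrightarrow> T (\<theta> j $$ (i, k))"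
    and dQ: "\<And>l i k. j = Suc l \<Longrightarrow> i < q l \<Longrightarrow> k < q j \<Longrightarrow> T (- dQ l $$ (i, k))"
    and zero: "T 0"
  shows "T (cone_diff p q dP dQ \<theta> j $$ (i, k))"
proof (cases j)
  case 0
  then show ?thesis
    using assms unfolding cone_diff_def cone_rank_def by (auto simp: less_Suc_eq)
next
  case (Suc l)
  have "dQ l \<in> carrier_mat (q l) (q j)" using assms(3)[of l] Suc by simp
  then show ?thesis
    using assms(1,2) i dP th dQ[OF Suc] zero Suc unfolding cone_diff_def cone_rank_def by auto
qed

context subring_set
begin

lemma append_vecs_in: "a \<in> vecs_in S m \<Longrightarrow> b \<in> vecs_in S n \<Longrightarrow> a @\<^sub>v b \<in> vecs_in S (m + n)"
  by (auto simp: vecs_in_def)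

lemma add_vecs_in: "v \<in> vecs_in S n \<Longrightarrow> w \<in> vecs_in S n \<Longrightarrow> v + w \<in> vecs_in S n"
  by (auto simp: vecs_in_def add_closed)

lemma split_vecs_in:
  assumes "x \<in> vecs_in S (m + n)"
  obtains a b where "a \<in> vecs_in S m" "b \<in> vecs_in S n" "x = a @\<^sub>v b"
proof
  show "vec_first x m \<in> vecs_in S m" "vec_last x n \<in> vecs_in S n" "x = vec_first x m @\<^sub>v vec_last x n"
    using assms by (auto simp: vecs_in_def vec_first_def vec_last_def intro!: eq_vecI)
qed

text \<open>
  The sequence \<open>0 \<rightarrow> S/(I : f) \<rightarrow> S/I \<rightarrow> S/(I + f) \<rightarrow> 0\<close> with first map the multiplication by \<open>f\<close> is
  exact, and the mapping cone of a lift \<open>\<theta>\<close> of that map resolves its cokernel. Above degree \<open>0\<close>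
  exactness is a diagram chase; in degree \<open>0\<close> it is the colon condition.
\<close>

lemma cone_resolves:
  assumes P: "resolves S p dP I" and Q: "resolves S q dQ K"
    and \<theta>: "\<And>j. \<theta> j \<in> mats_in S (p j) (q j)" "\<And>j. dP j * \<theta> (Suc j) = \<theta> j * dQ j"
    and f: "\<theta> 0 $$ (0, 0) = f"
    and colon: "\<And>b. b \<in> S \<Longrightarrow> f * b \<in> I \<Longrightarrow> b \<in> K"
  shows "resolves S (cone_rank p q) (cone_diff p q dP dQ \<theta>) {a + f * b | a b. a \<in> I \<and> b \<in> S}"
proof -
  let ?c = "cone_rank p q" and ?d = "cone_diff p q dP dQ \<theta>"
  have r0: "p 0 = 1" "q 0 = 1" using P Q by (auto simp: resolves_def)
  define q' where "q' j = (case j of 0 \<Rightarrow> 0 | Suc i \<Rightarrow> q i)" for j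
  define dQ' where "dQ' j = (case j of 0 \<Rightarrow> 0\<^sub>m 0 (q 0) | Suc i \<Rightarrow> - dQ i)" for j
  have c: "?c j = p j + q' j" "q' (Suc j) = q j" for j by (simp_all add: cone_rank_def q'_def)
  have d: "?d j = four_block_mat (dP j) (\<theta> j) (0\<^sub>m (q' j) (p (Suc j))) (dQ' j)" for j
    by (simp add: cone_diff_def q'_def dQ'_def)
  have dQ'S: "dQ' j \<in> mats_in S (q' j) (q j)" for j
    by (cases j) (auto simp: dQ'_def q'_def intro: zero_mats_in uminus_mats_in resolves_d[OF Q])
  note dc = mats_in_carrier[OF resolves_d[OF P]] mats_in_carrier[OF resolves_d[OF Q]]
    mats_in_carrier[OF \<theta>(1)] mats_in_carrier[OF dQ'S]
  have dS: "?d j \<in> mats_in S (?c j) (?c (Suc j))" for j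
  proof -
    have "?d j $$ (i, k) \<in> S" if "i < ?c j" "k < ?c (Suc j)" for i k
      by (rule elements_cone_diff[where T = "\<lambda>x. x \<in> S" and p = p and q = q and dP = dP and dQ = dQ and \<theta> = \<theta> and j = j, OF dc(1) dc(3) dc(2) that])
        (use resolves_d[OF P, of j] \<theta>(1)[of j] resolves_d[OF Q] zero_closed uminus_closed
         in \<open>auto simp: mats_in_def\<close>)
    moreover have "?d j \<in> carrier_mat (?c j) (?c (Suc j))"
      unfolding d c using four_block_carrier_mat[OF dc(1) dc(4)] by simp
    ultimately show ?thesis by (simp add: mats_in_def)
  qed
  have app: "?d j *\<^sub>v (a @\<^sub>v b) = (dP j *\<^sub>v a + \<theta> j *\<^sub>v b) @\<^sub>v (dQ' j *\<^sub>v b)"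
    if a: "a \<in> carrier_vec (p (Suc j))" and b: "b \<in> carrier_vec (q j)" for j a b
  proof -
    have "0\<^sub>m (q' j) (p (Suc j)) *\<^sub>v a + dQ' j *\<^sub>v b = dQ' j *\<^sub>v b"
      using a b dc(4)[of j] by (intro eq_vecI) auto
    then show ?thesis
      unfolding d by (subst four_block_mat_mult_vec[OF dc(1) dc(3) _ dc(4) a b]) auto
  qed
  have dQQ: "dQ' j * - dQ j = 0\<^sub>m (q' j) (q (Suc j))" for j
  proof (cases j)
    case 0
    then show ?thesis using dc(2)[of 0] by (intro eq_matI) (auto simp: dQ'_def q'_def)
  next
    case (Suc i)
    have "- dQ i * - dQ (Suc i) = dQ i * dQ (Suc i)"
      using dc(2)[of i] dc(2)[of "Suc i"] by (intro eq_matI) (auto simp: scalar_prod_def)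
    then show ?thesis using Q by (simp add: Suc dQ'_def q'_def resolves_def)
  qed
  have add_uminus: "M + - M = 0\<^sub>m k l" if "M \<in> carrier_mat k l" for M :: "'a mat" and k l
    using that by (intro eq_matI) auto
  have sq: "?d j * ?d (Suc j) = 0\<^sub>m (?c j) (?c (Suc (Suc j)))" for j
  proof -
    have 1: "dP j * \<theta> (Suc j) + \<theta> j * - dQ j = 0\<^sub>m (p j) (q (Suc j))"
    proof -
      have "\<theta> j * - dQ j = - (\<theta> j * dQ j)"
        using dc(3)[of j] dc(2)[of j] by (intro eq_matI) (auto simp: scalar_prod_def sum_negf)
      then show ?thesis
        unfolding \<theta>(2) by (simp add: add_uminus[OF mult_carrier_mat[OF dc(3) dc(2)]])
    qed
    have 2: "0\<^sub>m (q' j) (p (Suc j)) * \<theta> (Suc j) + dQ' j * - dQ j = 0\<^sub>m (q' j) (q (Suc j))"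
      unfolding dQQ using left_mult_zero_mat[OF dc(3)[of "Suc j"], of "q' j"] by simp
    have D: "?d (Suc j) = four_block_mat (dP (Suc j)) (\<theta> (Suc j)) (0\<^sub>m (q j) (p (Suc (Suc j)))) (- dQ j)"
      unfolding d c by (simp add: dQ'_def)
    have 3: "dP j * dP (Suc j) + \<theta> j * 0\<^sub>m (q j) (p (Suc (Suc j))) = 0\<^sub>m (p j) (p (Suc (Suc j)))"
      using P dc(3)[of j] by (simp add: resolves_def)
    have 4: "0\<^sub>m (q' j) (p (Suc j)) * dP (Suc j) + dQ' j * 0\<^sub>m (q j) (p (Suc (Suc j)))
        = 0\<^sub>m (q' j) (p (Suc (Suc j)))"
      using dc(1)[of "Suc j"] dc(4)[of j] by simp
    have "?d j * ?d (Suc j) = four_block_mat (0\<^sub>m (p j) (p (Suc (Suc j)))) (0\<^sub>m (p j) (q (Suc j)))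
        (0\<^sub>m (q' j) (p (Suc (Suc j)))) (0\<^sub>m (q' j) (q (Suc j)))"
      unfolding D d[of j]
      by (subst mult_four_block_mat[OF dc(1) dc(3) _ dc(4) dc(1) dc(3)])
        (use dc(2)[of j] in \<open>auto simp: 1 2 3 4\<close>)
    also have "\<dots> = 0\<^sub>m (?c j) (?c (Suc (Suc j)))"
      unfolding c by (intro eq_matI) auto
    finally show ?thesis .
  qed
  have exact: "\<exists>y\<in>vecs_in S (?c (Suc (Suc j))). ?d (Suc j) *\<^sub>v y = x"
    if x: "x \<in> vecs_in S (?c (Suc j))" and z: "?d j *\<^sub>v x = 0\<^sub>v (?c j)" for x j
  proof -
    obtain a b where ab: "a \<in> vecs_in S (p (Suc j))" "b \<in> vecs_in S (q j)" "x = a @\<^sub>v b"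
      using x unfolding c by (rule split_vecs_in)
    note abc = ab(1,2)[THEN vecs_in_carrier]
    have "(dP j *\<^sub>v a + \<theta> j *\<^sub>v b) @\<^sub>v (dQ' j *\<^sub>v b) = 0\<^sub>v (p j) @\<^sub>v 0\<^sub>v (q' j)"
      using z unfolding ab(3) app[OF abc] c by (auto intro!: eq_vecI)
    then have za: "dP j *\<^sub>v a + \<theta> j *\<^sub>v b = 0\<^sub>v (p j)" and zb: "dQ' j *\<^sub>v b = 0\<^sub>v (q' j)"
      using append_vec_eq[of "dP j *\<^sub>v a + \<theta> j *\<^sub>v b" "p j" "0\<^sub>v (p j)"] dc(1,3)[of j] abc by auto
    \<comment> \<open>The \<open>Q\<close>-component \<open>b\<close> of a cycle is a boundary of \<open>Q\<close>: in degree \<open>0\<close> because \<open>f b \<in> I\<close> puts \<open>b\<close>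
      into the ideal resolved by \<open>Q\<close>, in higher degrees because \<open>Q\<close> is exact.\<close>
    have "\<exists>w\<in>vecs_in S (q (Suc j)). dQ j *\<^sub>v w = b"
    proof (cases j)
      case 0
      have b0: "b $ 0 \<in> S" using ab(2) r0 0 by (auto simp: vecs_in_def)
      have th: "(\<theta> 0 *\<^sub>v b) $ 0 = f * b $ 0"
        using dc(3)[of 0] abc r0 f 0 by (auto simp: scalar_prod_def)
      have "(dP 0 *\<^sub>v a) $ 0 + f * b $ 0 = 0"
        using arg_cong[OF za, of "\<lambda>v. v $ 0"] th dc(1)[of 0] dc(3)[of 0] r0 abc 0 by auto
      then have "f * b $ 0 = - (dP 0 *\<^sub>v a) $ 0" by (simp add: eq_neg_iff_add_eq_0 add.commute)
      also have "\<dots> = (dP 0 *\<^sub>v (- a)) $ 0"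
        using dc(1)[of 0] abc r0 0 by (auto simp: scalar_prod_def sum_negf)
      also have "\<dots> \<in> I"
        by (rule resolves_image[OF P]) (use ab(1) 0 in \<open>auto simp: vecs_in_def uminus_closed\<close>)
      finally have "b $ 0 \<in> K" using colon b0 by blast
      then obtain w where w: "w \<in> vecs_in S (q 1)" "b $ 0 = (dQ 0 *\<^sub>v w) $ 0"
        using Q by (auto simp: resolves_def)
      have "dQ 0 *\<^sub>v w = b"
        using w dc(2)[of 0] abc(2) r0 0 by (intro eq_vecI) auto
      then show ?thesis using w 0 by auto
    next
      case (Suc i)
      have "dQ i *\<^sub>v b = - (dQ' j *\<^sub>v b)"
        using dc(2)[of i] abc(2) Suc by (intro eq_vecI) (auto simp: dQ'_def scalar_prod_def sum_negf)
      then have "dQ i *\<^sub>v b = 0\<^sub>v (q i)" using zb Suc by (simp add: q'_def)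
      then show ?thesis using resolves_exact[OF Q, of b i] ab(2) Suc by simp
    qed
    then obtain w where w: "w \<in> vecs_in S (q (Suc j))" "dQ j *\<^sub>v w = b" by blast
    note wc = vecs_in_carrier[OF w(1)]
    define e where "e = a + \<theta> (Suc j) *\<^sub>v w"
    have eS: "e \<in> vecs_in S (p (Suc j))"
      unfolding e_def by (rule add_vecs_in[OF ab(1) mult_vec_in[OF \<theta>(1) w(1)]])
    have "dP j *\<^sub>v e = dP j *\<^sub>v a + dP j *\<^sub>v (\<theta> (Suc j) *\<^sub>v w)"
      unfolding e_def by (rule mult_add_distrib_mat_vec[OF dc(1) abc(1) mult_mat_vec_carrier[OF dc(3) wc]])
    also have "dP j *\<^sub>v (\<theta> (Suc j) *\<^sub>v w) = \<theta> j *\<^sub>v b"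
      using assoc_mult_mat_vec[OF dc(1) dc(3) wc] assoc_mult_mat_vec[OF dc(3) dc(2) wc] \<theta>(2) w(2)
      by simp
    finally have "dP j *\<^sub>v e = 0\<^sub>v (p j)" using za by simp
    then obtain y where y: "y \<in> vecs_in S (p (Suc (Suc j)))" "dP (Suc j) *\<^sub>v y = e"
      using resolves_exact[OF P eS] by blast
    note yc = vecs_in_carrier[OF y(1)]
    have wS: "- w \<in> vecs_in S (q (Suc j))" using w(1) uminus_closed by (auto simp: vecs_in_def)
    have "?d (Suc j) *\<^sub>v (y @\<^sub>v - w) = (e + \<theta> (Suc j) *\<^sub>v (- w)) @\<^sub>v (- dQ j *\<^sub>v (- w))"
      using app[OF yc, of "- w"] wc y(2) by (simp add: dQ'_def)
    also have "\<theta> (Suc j) *\<^sub>v (- w) = - (\<theta> (Suc j) *\<^sub>v w)"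
      using dc(3)[of "Suc j"] wc by (intro eq_vecI) (auto simp: scalar_prod_def sum_negf)
    also have "e + - (\<theta> (Suc j) *\<^sub>v w) = a"
      using dc(3)[of "Suc j"] wc abc by (intro eq_vecI) (auto simp: e_def)
    also have "- dQ j *\<^sub>v (- w) = dQ j *\<^sub>v w"
      using dc(2)[of j] wc by (intro eq_vecI) (auto simp: scalar_prod_def sum_negf)
    finally have "?d (Suc j) *\<^sub>v (y @\<^sub>v - w) = x" by (simp add: w(2) ab(3))
    then show ?thesis using append_vecs_in[OF y(1) wS] unfolding c by blast
  qed
  have im: "(?d 0 *\<^sub>v (a @\<^sub>v b)) $ 0 = (dP 0 *\<^sub>v a) $ 0 + f * b $ 0"
    if "a \<in> vecs_in S (p 1)" "b \<in> vecs_in S 1" for a b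
  proof -
    have "(\<theta> 0 *\<^sub>v b) $ 0 = f * b $ 0"
      using dc(3)[of 0] vecs_in_carrier[OF that(2)] r0 f by (auto simp: scalar_prod_def)
    then show ?thesis
      using app[of a 0 b] that[THEN vecs_in_carrier] r0 dc(1,3)[of 0] by auto
  qed
  have "{a + f * b | a b. a \<in> I \<and> b \<in> S} = {(?d 0 *\<^sub>v x) $ 0 | x. x \<in> vecs_in S (?c 1)}"
  proof (intro equalityI subsetI)
    fix t assume "t \<in> {a + f * b | a b. a \<in> I \<and> b \<in> S}"
    then obtain x b where xb: "t = (dP 0 *\<^sub>v x) $ 0 + f * b" "x \<in> vecs_in S (p 1)" "b \<in> S"
      using P by (auto simp: resolves_def)
    define v where "v = vec 1 (\<lambda>_. b)"
    have v: "v \<in> vecs_in S 1" "v $ 0 = b" using xb by (auto simp: v_def vecs_in_def)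
    have "x @\<^sub>v v \<in> vecs_in S (?c 1)"
      using append_vecs_in[OF xb(2) v(1)] r0 by (simp add: cone_rank_def)
    then show "t \<in> {(?d 0 *\<^sub>v x) $ 0 | x. x \<in> vecs_in S (?c 1)}"
      using im[OF xb(2) v(1)] v(2) xb(1) by force
  next
    fix t assume "t \<in> {(?d 0 *\<^sub>v x) $ 0 | x. x \<in> vecs_in S (?c 1)}"
    then obtain x where x: "t = (?d 0 *\<^sub>v x) $ 0" "x \<in> vecs_in S (p 1 + 1)"
      by (auto simp: cone_rank_def r0)
    obtain a b where ab: "a \<in> vecs_in S (p 1)" "b \<in> vecs_in S 1" "x = a @\<^sub>v b"
      using x(2) by (rule split_vecs_in)
    have "(dP 0 *\<^sub>v a) $ 0 \<in> I" "b $ 0 \<in> S"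
      using P ab by (auto simp: resolves_def vecs_in_def)
    then show "t \<in> {a + f * b | a b. a \<in> I \<and> b \<in> S}"
      using im[OF ab(1,2)] x(1) ab(3) by auto
  qed
  then show ?thesis
    unfolding resolves_def using dS sq exact r0 by (auto simp: cone_rank_def)
qed

end

section \<open>Linear resolutions over the polynomial ring\<close>

abbreviation "lookup \<equiv> Poly_Mapping.lookup"
abbreviation "keys \<equiv> Poly_Mapping.keys"
abbreviation "single \<equiv> Poly_Mapping.single"

definition var_set :: "nat \<Rightarrow> cut_var set" where
  "var_set n = Sv ` {1..n} \<union> Tv ` {1..n}"

definition poly_set :: "nat \<Rightarrow> 'k::field cut_poly set" where
  "poly_set n = {p. \<forall>m\<in>keys p. keys m \<subseteq> var_set n}"

lemma finite_var_set: "finite (var_set n)"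
  by (simp add: var_set_def)

lemma keys_add_nat: "keys (a + b) = keys a \<union> keys (b :: 'a \<Rightarrow>\<^sub>0 nat)"
  by (auto simp: in_keys_iff lookup_add)

lemma keys_mult_elim:
  assumes "m \<in> keys (p * q)"
  obtains a b where "a \<in> keys p" "b \<in> keys q" "m = a + b"
  using keys_mult[of p q] assms by blast

lemma subring_set_poly: "subring_set (poly_set n :: 'k::field cut_poly set)"
proof
  fix a b :: "'k cut_poly" assume ab: "a \<in> poly_set n" "b \<in> poly_set n"
  show "a + b \<in> poly_set n"
    using ab keys_add[of a b] by (auto simp: poly_set_def)
  show "a * b \<in> poly_set n"
    using ab by (auto simp: poly_set_def keys_add_nat elim!: keys_mult_elim; blast)
qed (auto simp: poly_set_def)

interpretation poly: subring_set "poly_set n :: 'k::field cut_poly set" for n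
  by (rule subring_set_poly)

text \<open>
  Summing over the finite set of admissible variables makes the degree additive at once; on exponents
  of polynomials in \<open>poly_set n\<close> it is the total degree.
\<close>

definition mon_degree :: "nat \<Rightarrow> (cut_var \<Rightarrow>\<^sub>0 nat) \<Rightarrow> nat" where
  "mon_degree n m = (\<Sum>v\<in>var_set n. lookup m v)"

lemma mon_degree_add: "mon_degree n (a + b) = mon_degree n a + mon_degree n b"
  by (simp add: mon_degree_def lookup_add sum.distrib)

definition homogeneous :: "nat \<Rightarrow> nat \<Rightarrow> 'k::field cut_poly \<Rightarrow> bool" where
  "homogeneous n k p \<longleftrightarrow> (\<forall>m\<in>keys p. mon_degree n m = k)"

lemma homogeneous_zero: "homogeneous n k 0"
  by (simp add: homogeneous_def)

lemma homogeneous_uminus: "homogeneous n k p \<Longrightarrow> homogeneous n k (- p)"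
  by (simp add: homogeneous_def)

lemma homogeneous_mult: "homogeneous n a p \<Longrightarrow> homogeneous n b q \<Longrightarrow> homogeneous n (a + b) (p * q)"
  by (auto simp: homogeneous_def mon_degree_add elim!: keys_mult_elim)

lemma homogeneous_sum: "(\<And>i. i \<in> I \<Longrightarrow> homogeneous n k (f i)) \<Longrightarrow> homogeneous n k (sum f I)"
  using keys_sum[of f I] by (auto simp: homogeneous_def)

definition filter_keys :: "('a \<Rightarrow> bool) \<Rightarrow> ('a \<Rightarrow>\<^sub>0 'b::zero) \<Rightarrow> 'a \<Rightarrow>\<^sub>0 'b" where
  "filter_keys P p = Poly_Mapping.mapp (\<lambda>m c. if P m then c else 0) p"

lemma lookup_filter_keys: "lookup (filter_keys P p) m = (if P m then lookup p m else 0)"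
  by (auto simp: filter_keys_def lookup_mapp in_keys_iff when_def)

lemma keys_filter_keys: "keys (filter_keys P p) = {m \<in> keys p. P m}"
  by (auto simp: in_keys_iff lookup_filter_keys split: if_splits)

lemma filter_keys_split: "p = filter_keys P p + filter_keys (\<lambda>m. \<not> P m) p"
  for p :: "'a \<Rightarrow>\<^sub>0 'b::comm_monoid_add"
  by (rule poly_mapping_eqI) (simp add: lookup_add lookup_filter_keys)

lemma filter_keys_add: "filter_keys P (p + q) = filter_keys P p + filter_keys P q"
  for p :: "'a \<Rightarrow>\<^sub>0 'b::comm_monoid_add"
  by (rule poly_mapping_eqI) (simp add: lookup_add lookup_filter_keys)

lemma filter_keys_zero: "filter_keys P 0 = 0"
  by (rule poly_mapping_eqI) (simp add: lookup_filter_keys)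

lemma filter_keys_sum: "filter_keys P (sum f I) = (\<Sum>i\<in>I. filter_keys P (f i))"
  for f :: "_ \<Rightarrow> 'a \<Rightarrow>\<^sub>0 'b::comm_monoid_add"
  by (induction I rule: infinite_finite_induct) (auto simp: filter_keys_zero filter_keys_add)

lemma filter_keys_all: "(\<And>m. m \<in> keys p \<Longrightarrow> P m) \<Longrightarrow> filter_keys P p = p"
  by (rule poly_mapping_eqI) (auto simp: lookup_filter_keys in_keys_iff)

lemma filter_keys_none: "(\<And>m. m \<in> keys p \<Longrightarrow> \<not> P m) \<Longrightarrow> filter_keys P p = 0"
  by (rule poly_mapping_eqI) (auto simp: lookup_filter_keys in_keys_iff)

definition degree_part :: "nat \<Rightarrow> nat \<Rightarrow> 'k::field cut_poly \<Rightarrow> 'k cut_poly" where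
  "degree_part n k = filter_keys (\<lambda>m. mon_degree n m = k)"

lemma homogeneous_degree_part: "homogeneous n k (degree_part n k p)"
  by (simp add: homogeneous_def degree_part_def keys_filter_keys)

lemma degree_part_in: "p \<in> poly_set n \<Longrightarrow> degree_part n k p \<in> poly_set n"
  by (simp add: poly_set_def degree_part_def keys_filter_keys)

lemma degree_part_homogeneous: "homogeneous n k p \<Longrightarrow> degree_part n k p = p"
  by (simp add: homogeneous_def degree_part_def filter_keys_all)

lemma degree_part_mult:
  assumes "homogeneous n a p"
  shows "degree_part n (a + k) (p * q) = p * degree_part n k q"
proof -
  define r where "r = filter_keys (\<lambda>m. mon_degree n m \<noteq> k) q"
  have q: "q = degree_part n k q + r" unfolding degree_part_def r_def by (rule filter_keys_split)
  have "degree_part n (a + k) (p * r) = 0"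
    unfolding degree_part_def
    by (rule filter_keys_none) (use assms in \<open>auto simp: homogeneous_def r_def keys_filter_keys mon_degree_add elim!: keys_mult_elim\<close>)
  moreover have "degree_part n (a + k) (p * degree_part n k q) = p * degree_part n k q"
    by (intro degree_part_homogeneous homogeneous_mult assms homogeneous_degree_part)
  moreover have "degree_part n (a + k) (p * q) = degree_part n (a + k) (p * degree_part n k q) + degree_part n (a + k) (p * r)"
    by (subst q) (simp only: distrib_left degree_part_def filter_keys_add)
  ultimately show ?thesis by simp
qed

definition hom_mat :: "nat \<Rightarrow> nat \<Rightarrow> 'k::field cut_poly mat \<Rightarrow> bool" where
  "hom_mat n k A \<longleftrightarrow> (\<forall>i<dim_row A. \<forall>j<dim_col A. homogeneous n k (A $$ (i, j)))"

lemma hom_mat_mult: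
  assumes "hom_mat n a A" "hom_mat n b B" "dim_col A = dim_row B"
  shows "hom_mat n (a + b) (A * B)"
  using assms unfolding hom_mat_def
  by (auto simp: scalar_prod_def intro!: homogeneous_sum homogeneous_mult)

text \<open>
  A homogeneous system has a homogeneous solution if it has any: the other degrees of the solution
  contribute nothing to the right-hand side.
\<close>

lemma homogeneous_solution:
  fixes A :: "'k::field cut_poly mat"
  assumes A: "A \<in> mats_in (poly_set n) l m" "hom_mat n a A"
    and Z: "Z \<in> mats_in (poly_set n) m k" and X: "hom_mat n (a + b) (A * Z)"
  shows "\<exists>Y\<in>mats_in (poly_set n) m k. hom_mat n b Y \<and> A * Y = A * Z"
proof
  define Y where "Y = map_mat (degree_part n b) Z"
  show "Y \<in> mats_in (poly_set n) m k"
    using Z by (auto simp: Y_def mats_in_def degree_part_in)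
  have "(A * Y) $$ (i, j) = (A * Z) $$ (i, j)" if ij: "i < l" "j < k" for i j
  proof -
    have "(A * Z) $$ (i, j) = degree_part n (a + b) ((A * Z) $$ (i, j))"
      using X ij A(1) Z by (intro degree_part_homogeneous[symmetric]) (auto simp: hom_mat_def mats_in_def)
    also have "\<dots> = (\<Sum>x\<in>{0..<m}. degree_part n (a + b) (A $$ (i, x) * Z $$ (x, j)))"
      using ij A(1) Z by (auto simp: mats_in_def scalar_prod_def degree_part_def filter_keys_sum)
    also have "\<dots> = (\<Sum>x\<in>{0..<m}. A $$ (i, x) * degree_part n b (Z $$ (x, j)))"
      using A ij by (intro sum.cong degree_part_mult) (auto simp: hom_mat_def mats_in_def)
    also have "\<dots> = (A * Y) $$ (i, j)"
      using ij A(1) Z by (auto simp: mats_in_def scalar_prod_def Y_def)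
    finally show ?thesis by simp
  qed
  then have "A * Y = A * Z"
    using A(1) Z by (intro eq_matI) (auto simp: mats_in_def Y_def)
  moreover have "hom_mat n b Y" by (auto simp: hom_mat_def Y_def homogeneous_degree_part)
  ultimately show "hom_mat n b Y \<and> A * Y = A * Z" by simp
qed

text \<open>
  The resolution of \<open>S/J\<close> for an ideal \<open>J\<close> with a linear resolution and generators of degree \<open>D\<close>.
\<close>

definition linear_resolution ::
  "nat \<Rightarrow> nat \<Rightarrow> (nat \<Rightarrow> nat) \<Rightarrow> (nat \<Rightarrow> 'k::field cut_poly mat) \<Rightarrow> 'k cut_poly set \<Rightarrow> bool" where
  "linear_resolution n D r d J \<longleftrightarrow> resolves (poly_set n) r d J \<and> hom_mat n D (d 0) \<and>
     (\<forall>j. hom_mat n 1 (d (Suc j)))"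

text \<open>
  The entries of the lift \<open>\<theta>\<close> can be chosen linear from degree \<open>1\<close> on. At the first step
  \<open>f dQ 0\<close> has degree \<open>D + 1\<close> and has to be lifted along \<open>dP 0\<close>, of degree \<open>D\<close>; at later steps a matrix
  of quadrics is lifted along one of linear forms.
\<close>

lemma cone_linear_resolution:
  fixes f :: "'k::field cut_poly"
  assumes P: "linear_resolution n D p dP I" and Q: "linear_resolution n 1 q dQ K"
    and f: "f \<in> poly_set n" "homogeneous n D f" and K: "K = {b \<in> poly_set n. f * b \<in> I}"
  shows "\<exists>d. linear_resolution n D (cone_rank p q) d {a + f * b | a b. a \<in> I \<and> b \<in> poly_set n}"
proof -
  have rP: "resolves (poly_set n) p dP I" and hP: "hom_mat n D (dP 0)" "\<And>j. hom_mat n 1 (dP (Suc j))"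
    and rQ: "resolves (poly_set n) q dQ K" and hQ: "hom_mat n 1 (dQ j)" for j
    using P Q by (cases j; auto simp: linear_resolution_def)+
  have r0: "p 0 = 1" "q 0 = 1" using rP rQ by (auto simp: resolves_def)
  note dP = poly.resolves_d[OF rP] note dQ = poly.resolves_d[OF rQ]
  note dPc = mats_in_carrier[OF dP] note dQc = mats_in_carrier[OF dQ]
  define F where "F = mat 1 1 (\<lambda>_. f)"
  have F: "F \<in> mats_in (poly_set n) 1 1" "hom_mat n D F"
    using f by (auto simp: F_def mats_in_def hom_mat_def)
  have "\<exists>Y\<in>mats_in (poly_set n) (p 1) (q 1). hom_mat n 1 Y \<and> dP 0 * Y = F * dQ 0"
  proof -
    have FdQ: "F * dQ 0 \<in> mats_in (poly_set n) 1 (q 1)"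
      using poly.mult_mats_in[OF F(1), of "dQ 0" "q 1"] dQ[of 0] r0 by simp
    have "(F * dQ 0) $$ (0, i) \<in> I" if i: "i < q 1" for i
    proof -
      have "dQ 0 $$ (0, i) \<in> K" by (rule poly.resolves_generator[OF rQ i])
      moreover have "(F * dQ 0) $$ (0, i) = f * dQ 0 $$ (0, i)"
        using dQc[of 0] i r0 by (auto simp: F_def scalar_prod_def)
      ultimately show ?thesis by (simp add: K)
    qed
    from poly.lift_ideal[OF rP FdQ this] obtain Z
      where Z: "Z \<in> mats_in (poly_set n) (p 1) (q 1)" "dP 0 * Z = F * dQ 0" by blast
    have "hom_mat n (D + 1) (dP 0 * Z)"
      unfolding Z(2) by (rule hom_mat_mult[OF F(2) hQ]) (use dQc[of 0] r0 in \<open>auto simp: F_def\<close>)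
    from homogeneous_solution[OF _ hP(1) Z(1) this, of "p 0"] dP[of 0] Z(2) show ?thesis by simp
  qed
  moreover have "\<exists>Z'\<in>mats_in (poly_set n) (p (Suc (Suc j))) (q (Suc (Suc j))).
      hom_mat n 1 Z' \<and> dP (Suc j) * Z' = Y * dQ (Suc j)"
    if Y: "Y \<in> mats_in (poly_set n) (p (Suc j)) (q (Suc j))" "hom_mat n 1 Y"
      and Z: "Z \<in> mats_in (poly_set n) (p (Suc (Suc j))) (q (Suc (Suc j)))" "dP (Suc j) * Z = Y * dQ (Suc j)"
    for j Y Z
  proof -
    have "hom_mat n (1 + 1) (dP (Suc j) * Z)"
      unfolding Z(2) by (rule hom_mat_mult[OF Y(2) hQ])
        (use mats_in_carrier[OF Y(1)] dQc[of "Suc j"] in auto)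
    from homogeneous_solution[OF dP hP(2) Z(1) this] show ?thesis by (simp add: Z(2))
  qed
  ultimately obtain \<theta> where \<theta>: "\<theta> 0 = F" "\<And>j. \<theta> j \<in> mats_in (poly_set n) (p j) (q j)"
      "\<And>j. hom_mat n 1 (\<theta> (Suc j))" "\<And>j. dP j * \<theta> (Suc j) = \<theta> j * dQ j"
    using poly.chain_map_exists[OF rQ rP F(1), of "hom_mat n 1"] by blast
  have "resolves (poly_set n) (cone_rank p q) (cone_diff p q dP dQ \<theta>)
      {a + f * b | a b. a \<in> I \<and> b \<in> poly_set n}"
    by (rule poly.cone_resolves[OF rP rQ \<theta>(2,4)]) (auto simp: \<theta>(1) F_def K)
  moreover have hom: "hom_mat n (if j = 0 then D else 1) (cone_diff p q dP dQ \<theta> j)" for j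
  proof -
    have e: "homogeneous n (if j = 0 then D else 1) (cone_diff p q dP dQ \<theta> j $$ (i, k))"
      if ik: "i < cone_rank p q j" "k < cone_rank p q (Suc j)" for i k
    proof (rule elements_cone_diff[where T = "homogeneous n (if j = 0 then D else 1)" and p = p and q = q
          and dP = dP and dQ = dQ and \<theta> = \<theta> and j = j, OF dPc mats_in_carrier[OF \<theta>(2)] dQc ik])
      show "homogeneous n (if j = 0 then D else 1) (dP j $$ (i, k))" if "i < p j" "k < p (Suc j)" for i k
        using that hP dPc[of j] by (cases j) (auto simp: hom_mat_def)
      show "homogeneous n (if j = 0 then D else 1) (\<theta> j $$ (i, k))" if "i < p j" "k < q j" for i k
        using that F(2) \<theta>(1,3) mats_in_carrier[OF \<theta>(2)[of j]] by (cases j) (auto simp: hom_mat_def)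
      show "homogeneous n (if j = 0 then D else 1) (- dQ l $$ (i, k))"
        if "j = Suc l" "i < q l" "k < q j" for l i k
        using that hQ[of l] dQc[of l] by (auto simp: hom_mat_def homogeneous_uminus)
    qed (rule homogeneous_zero)
    moreover have "cone_diff p q dP dQ \<theta> j \<in> carrier_mat (cone_rank p q j) (cone_rank p q (Suc j))"
      using calculation \<open>resolves _ (cone_rank p q) _ _\<close> poly.resolves_d mats_in_carrier by blast
    ultimately show ?thesis by (auto simp: hom_mat_def)
  qed
  moreover have "hom_mat n D (cone_diff p q dP dQ \<theta> 0)" using hom[of 0] by simp
  moreover have "hom_mat n 1 (cone_diff p q dP dQ \<theta> (Suc j))" for j using hom[of "Suc j"] by simp
  ultimately have "linear_resolution n D (cone_rank p q) (cone_diff p q dP dQ \<theta>)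
      {a + f * b | a b. a \<in> I \<and> b \<in> poly_set n}"
    unfolding linear_resolution_def by blast
  then show ?thesis by blast
qed

section \<open>Monomial ideals and Koszul complexes\<close>

definition mon_divides :: "('a \<Rightarrow>\<^sub>0 nat) \<Rightarrow> ('a \<Rightarrow>\<^sub>0 nat) \<Rightarrow> bool" where
  "mon_divides g m \<longleftrightarrow> (\<forall>v. lookup g v \<le> lookup m v)"

lemma mon_divides_iff: "mon_divides g m \<longleftrightarrow> (\<exists>h. m = g + h)"
proof
  assume "mon_divides g m"
  then have "m = g + (m - g)"
    by (intro poly_mapping_eqI) (simp add: mon_divides_def lookup_add lookup_minus)
  then show "\<exists>h. m = g + h" ..
qed (auto simp: mon_divides_def lookup_add)

text \<open>
  A polynomial lies in a monomial ideal iff each of its monomials does. This turns sums, colons and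
  intersections of such ideals into statements about exponents.
\<close>

definition mon_ideal :: "nat \<Rightarrow> (cut_var \<Rightarrow>\<^sub>0 nat) set \<Rightarrow> 'k::field cut_poly set" where
  "mon_ideal n G = {p \<in> poly_set n. \<forall>m\<in>keys p. \<exists>g\<in>G. mon_divides g m}"

lemma lookup_single_mult: "lookup (single g 1 * b) (g + h) = lookup b h"
  for b :: "'k::field cut_poly"
  unfolding lookup_mult by (simp add: lookup_single when_mult Sum_any_when_equal)

lemma keys_single_mult: "keys (single g 1 * b) = (+) g ` keys b" for b :: "'k::field cut_poly"
proof
  show "keys (single g 1 * b) \<subseteq> (+) g ` keys b"
    by (auto elim!: keys_mult_elim split: if_splits)
  show "(+) g ` keys b \<subseteq> keys (single g 1 * b)"
    by (auto simp: in_keys_iff lookup_single_mult)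
qed

text \<open>
  The monomials of \<open>p\<close> that are multiples of \<open>g\<close> form a multiple of \<open>g\<close>, and the others lie in the
  ideal of \<open>G\<close>.
\<close>

lemma mon_ideal_insert:
  assumes g: "keys g \<subseteq> var_set n"
  shows "mon_ideal n (insert g G) =
    {a + single g 1 * b | a b. a \<in> mon_ideal n G \<and> b \<in> (poly_set n :: 'k::field cut_poly set)}"
proof (intro equalityI subsetI)
  fix p :: "'k cut_poly" assume p: "p \<in> mon_ideal n (insert g G)"
  define b where "b = Poly_Mapping.map_key ((+) g) (filter_keys (mon_divides g) p)"
  define a where "a = filter_keys (\<lambda>m. \<not> mon_divides g m) p"
  have inj: "inj ((+) g)" by simp
  have lb: "lookup b h = lookup p (g + h)" for h
    using mon_divides_iff[of g "g + h"] by (auto simp: b_def map_key.rep_eq[OF inj] lookup_filter_keys)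
  have "single g 1 * b = filter_keys (mon_divides g) p"
  proof (rule poly_mapping_eqI)
    fix m show "lookup (single g 1 * b) m = lookup (filter_keys (mon_divides g) p) m"
    proof (cases "mon_divides g m")
      case True
      then show ?thesis by (auto simp: mon_divides_iff lookup_single_mult lb lookup_filter_keys)
    next
      case False
      then have "m \<notin> keys (single g 1 * b)" by (auto simp: keys_single_mult mon_divides_iff)
      with False show ?thesis by (simp add: in_keys_iff lookup_filter_keys)
    qed
  qed
  then have "p = a + single g 1 * b"
    using filter_keys_split[of p "mon_divides g"] by (simp add: a_def add.commute)
  moreover have "a \<in> mon_ideal n G" using p by (auto simp: mon_ideal_def poly_set_def a_def keys_filter_keys)
  moreover have "b \<in> poly_set n"
  proof -
    have "keys h \<subseteq> var_set n" if "h \<in> keys b" for h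
    proof -
      have "g + h \<in> keys p" using that by (simp add: in_keys_iff lb)
      then have "keys (g + h) \<subseteq> var_set n" using p by (simp add: mon_ideal_def poly_set_def)
      then show ?thesis by (simp add: keys_add_nat)
    qed
    then show ?thesis by (simp add: poly_set_def)
  qed
  ultimately show "p \<in> {a + single g 1 * b | a b. a \<in> mon_ideal n G \<and> b \<in> poly_set n}" by blast
next
  fix p :: "'k cut_poly" assume "p \<in> {a + single g 1 * b | a b. a \<in> mon_ideal n G \<and> b \<in> poly_set n}"
  then obtain a b where p: "p = a + single g 1 * b" and a: "a \<in> mon_ideal n G" and b: "b \<in> poly_set n"
    by blast
  have "keys p \<subseteq> keys a \<union> (+) g ` keys b"
    using keys_add[of a "single g 1 * b"] by (simp add: p keys_single_mult)
  moreover have "\<forall>m\<in>keys a. keys m \<subseteq> var_set n \<and> (\<exists>h\<in>G. mon_divides h m)"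
    using a by (simp add: mon_ideal_def poly_set_def)
  moreover have "\<forall>m\<in>(+) g ` keys b. keys m \<subseteq> var_set n \<and> mon_divides g m"
    using b g by (auto simp: poly_set_def keys_add_nat mon_divides_iff)
  ultimately show "p \<in> mon_ideal n (insert g G)"
    unfolding mon_ideal_def poly_set_def by blast
qed

lemma mon_ideal_colon:
  assumes g: "keys g \<subseteq> var_set n"
    and colon: "\<And>m. keys m \<subseteq> var_set n \<Longrightarrow>
      (\<exists>h\<in>G. mon_divides h (g + m)) \<longleftrightarrow> (\<exists>h\<in>H. mon_divides h m)"
  shows "(mon_ideal n H :: 'k::field cut_poly set) = {b \<in> poly_set n. single g 1 * b \<in> mon_ideal n G}"
proof -
  have "single g 1 * b \<in> mon_ideal n G \<longleftrightarrow> b \<in> mon_ideal n H" if b: "b \<in> poly_set n" for b :: "'k cut_poly"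
  proof -
    have "\<And>m. m \<in> keys b \<Longrightarrow> keys m \<subseteq> var_set n" using b by (simp add: poly_set_def)
    then show ?thesis
      using b g colon by (auto simp: mon_ideal_def poly_set_def keys_single_mult keys_add_nat)
  qed
  then show ?thesis by (auto simp: mon_ideal_def)
qed

lemma linear_resolution_insert:
  assumes P: "linear_resolution n (mon_degree n g) p dP (mon_ideal n G :: 'k::field cut_poly set)"
    and Q: "linear_resolution n 1 q dQ (mon_ideal n H :: 'k cut_poly set)"
    and g: "keys g \<subseteq> var_set n"
    and colon: "\<And>m. keys m \<subseteq> var_set n \<Longrightarrow>
      (\<exists>h\<in>G. mon_divides h (g + m)) \<longleftrightarrow> (\<exists>h\<in>H. mon_divides h m)"
  shows "\<exists>d. linear_resolution n (mon_degree n g) (cone_rank p q) d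
    (mon_ideal n (insert g G) :: 'k cut_poly set)"
  unfolding mon_ideal_insert[OF g]
  by (rule cone_linear_resolution[OF P Q _ _ mon_ideal_colon[OF g colon]])
    (use g in \<open>auto simp: poly_set_def homogeneous_def\<close>)

lemma linear_resolution_empty:
  "linear_resolution n D (\<lambda>j. if j = 0 then 1 else 0) (\<lambda>j. 0\<^sub>m (if j = 0 then 1 else 0) 0)
    (mon_ideal n {} :: 'k::field cut_poly set)"
proof -
  have I: "mon_ideal n {} = {0 :: 'k cut_poly}"
    by (auto simp: mon_ideal_def poly_set_def)
  have "resolves (poly_set n) (\<lambda>j. if j = 0 then 1 else 0) (\<lambda>j. 0\<^sub>m (if j = 0 then 1 else 0) 0)
      {0 :: 'k cut_poly}"
    unfolding resolves_def
  proof (intro conjI allI ballI impI)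
    fix j and x :: "'k cut_poly vec" assume "x \<in> vecs_in (poly_set n) (if Suc j = 0 then 1 else 0)"
    then have x: "x = 0\<^sub>v 0" by (auto simp: vecs_in_def)
    show "\<exists>y\<in>vecs_in (poly_set n) (if Suc (Suc j) = 0 then 1 else 0).
        0\<^sub>m (if Suc j = 0 then 1 else 0) 0 *\<^sub>v y = x"
      by (rule bexI[of _ "0\<^sub>v 0"]) (auto simp: x vecs_in_def)
  next
    show "{0 :: 'k cut_poly} = {(0\<^sub>m (if (0::nat) = 0 then 1 else 0) 0 *\<^sub>v x) $ 0 |x.
        x \<in> vecs_in (poly_set n) (if (1::nat) = 0 then 1 else 0)}"
      by (auto simp: vecs_in_def scalar_prod_def intro!: exI[of _ "0\<^sub>v 0"])
  qed (auto simp: mats_in_def)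
  then show ?thesis by (simp add: I linear_resolution_def hom_mat_def)
qed

text \<open>
  The Koszul complex as an iterated mapping cone: a variable outside \<open>V\<close> is a nonzerodivisor modulo \<open>V\<close>,
  so the colon ideal is \<open>V\<close> itself, and the ranks add up by Pascal's rule.
\<close>

lemma koszul_resolution:
  assumes "finite V" "V \<subseteq> var_set n"
  shows "\<exists>d. linear_resolution n 1 (\<lambda>j. card V choose j) d
    (mon_ideal n ((\<lambda>v. single v 1) ` V) :: 'k::field cut_poly set)"
  using assms
proof (induction V rule: finite_induct)
  case empty
  have "(\<lambda>j. 0 choose j) = (\<lambda>j. if j = 0 then 1 else 0)" by (auto simp: binomial_eq_0)
  then show ?case using linear_resolution_empty[of n 1] by auto
next
  case (insert x V)
  let ?e = "\<lambda>v. single v (1::nat)"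
  obtain d where d: "linear_resolution n 1 (\<lambda>j. card V choose j) d (mon_ideal n (?e ` V) :: 'k cut_poly set)"
    using insert by auto
  have x: "mon_degree n (?e x) = 1"
    using insert.prems finite_var_set by (simp add: mon_degree_def lookup_single when_def)
  have dv: "mon_divides (?e v) m \<longleftrightarrow> lookup m v \<noteq> 0" for v m
    by (auto simp: mon_divides_def lookup_single when_def)
  have "\<exists>d. linear_resolution n (mon_degree n (?e x)) (cone_rank (\<lambda>j. card V choose j) (\<lambda>j. card V choose j)) d
      (mon_ideal n (insert (?e x) (?e ` V)) :: 'k cut_poly set)"
  proof (rule linear_resolution_insert)
    show "(\<exists>h\<in>?e ` V. mon_divides h (?e x + m)) \<longleftrightarrow> (\<exists>h\<in>?e ` V. mon_divides h m)" for m
      using insert.hyps(2) by (auto simp: dv[unfolded One_nat_def] lookup_add lookup_single when_def)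
  qed (use d x insert.prems in auto)
  then obtain d' where d': "linear_resolution n (mon_degree n (?e x)) (cone_rank (\<lambda>j. card V choose j) (\<lambda>j. card V choose j)) d'
      (mon_ideal n (insert (?e x) (?e ` V)) :: 'k cut_poly set)" by blast
  have r: "cone_rank (\<lambda>j. card V choose j) (\<lambda>j. card V choose j) = (\<lambda>j. card (insert x V) choose j)"
    using insert.hyps by (auto simp: fun_eq_iff cone_rank_def split: nat.splits)
  show ?case using d' unfolding x r by (intro exI[of _ d']) (simp only: image_insert)
qed

section \<open>Double words have linear quotients\<close>

text \<open>The ranks of a resolution of \<open>S/J\<close> from those of a resolution of \<open>J\<close>.\<close>

definition aug_rank :: "(nat \<Rightarrow> nat) \<Rightarrow> nat \<Rightarrow> nat" where
  "aug_rank r j = (case j of 0 \<Rightarrow> 1 | Suc l \<Rightarrow> r l)"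

definition word :: "nat \<Rightarrow> nat set \<Rightarrow> cut_var \<Rightarrow>\<^sub>0 nat" where
  "word m E = (\<Sum>k\<in>{1..m}. single (if k \<in> E then Sv k else Tv k) 1)"

text \<open>
  For \<open>(I, i)\<close> with \<open>i \<in> I\<close> the word of \<open>I\<close> has the letter \<open>s_i\<close>, so that the extra \<open>t_i\<close> gives
  the factor \<open>s_i t_i\<close>.
\<close>

definition double_word :: "nat \<Rightarrow> nat set \<times> nat \<Rightarrow> cut_var \<Rightarrow>\<^sub>0 nat" where
  "double_word m x = word m (fst x) + single (Tv (snd x)) 1"

definition marked_subsets :: "nat \<Rightarrow> (nat set \<times> nat) set" where
  "marked_subsets m = (SIGMA I:Pow {1..m}. I)"

lemma finite_marked_subsets: "finite (marked_subsets m)"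
  unfolding marked_subsets_def by (intro finite_SigmaI) (auto intro: finite_subset)

lemma lookup_word:
  "lookup (word m E) (Sv k) = (if k \<in> {1..m} \<inter> E then 1 else 0)"
  "lookup (word m E) (Tv k) = (if k \<in> {1..m} - E then 1 else 0)"
proof -
  have "lookup (word m E) (Sv k) = (\<Sum>i\<in>{1..m}. if i = k then (if k \<in> E then 1 else 0) else 0)"
    unfolding word_def lookup_sum by (intro sum.cong) (auto simp: lookup_single when_def)
  then show "lookup (word m E) (Sv k) = (if k \<in> {1..m} \<inter> E then 1 else 0)" by simp
  have "lookup (word m E) (Tv k) = (\<Sum>i\<in>{1..m}. if i = k then (if k \<in> E then 0 else 1) else 0)"
    unfolding word_def lookup_sum by (intro sum.cong) (auto simp: lookup_single when_def)
  then show "lookup (word m E) (Tv k) = (if k \<in> {1..m} - E then 1 else 0)" by simp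
qed

lemma lookup_double_word:
  "lookup (double_word m (I, i)) (Sv k) = (if k \<in> {1..m} \<inter> I then 1 else 0)"
  "lookup (double_word m (I, i)) (Tv k) = (if k \<in> {1..m} - I then 1 else 0) + (if k = i then 1 else 0)"
  by (auto simp: double_word_def lookup_add lookup_word lookup_single when_def)

lemma keys_word: "m \<le> n \<Longrightarrow> keys (word m E) \<subseteq> var_set n"
proof
  fix v assume "m \<le> n" "v \<in> keys (word m E)"
  then show "v \<in> var_set n"
    by (cases v) (auto simp: in_keys_iff lookup_word var_set_def split: if_splits)
qed

lemma keys_double_word: "m \<le> n \<Longrightarrow> x \<in> marked_subsets m \<Longrightarrow> keys (double_word m x) \<subseteq> var_set n"
  using keys_word[of m n "fst x"]
  by (auto simp: double_word_def keys_add_nat marked_subsets_def var_set_def split: if_splits)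

lemma mon_degree_single: "v \<in> var_set n \<Longrightarrow> mon_degree n (single v 1) = 1"
  using finite_var_set by (simp add: mon_degree_def lookup_single when_def)

lemma mon_degree_word: "m \<le> n \<Longrightarrow> mon_degree n (word m E) = m"
proof -
  assume m: "m \<le> n"
  have "mon_degree n (\<Sum>k\<in>A. f k) = (\<Sum>k\<in>A. mon_degree n (f k))" if "finite A" for A and f :: "nat \<Rightarrow> _"
    using that by (induction A) (auto simp: mon_degree_add, simp add: mon_degree_def)
  then have "mon_degree n (word m E) = (\<Sum>k\<in>{1..m}. 1)"
    unfolding word_def using m
    by (simp only: finite_atLeastAtMost) (intro sum.cong refl mon_degree_single, auto simp: var_set_def)
  then show ?thesis by simp
qed

lemma mon_degree_double_word:
  "m \<le> n \<Longrightarrow> x \<in> marked_subsets m \<Longrightarrow> mon_degree n (double_word m x) = m + 1"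
  by (auto simp: double_word_def mon_degree_add mon_degree_word mon_degree_single[unfolded One_nat_def]
      marked_subsets_def var_set_def)

definition colon_vars :: "nat \<Rightarrow> nat set \<times> nat \<Rightarrow> cut_var set" where
  "colon_vars m x = Sv ` ({1..m} - fst x) \<union> Tv ` {k \<in> fst x. k < snd x}"

lemma card_colon_vars:
  assumes "I \<subseteq> {1..n - 1}" shows "card (colon_vars (n - 1) (I, i)) = r_num n I i"
proof -
  have fin: "finite I" using assms finite_subset by blast
  have "card (colon_vars (n - 1) (I, i)) = card ({1..n - 1} - I) + card {k \<in> I. k < i}"
    unfolding colon_vars_def using fin
    by (subst card_Un_disjoint) (auto simp: card_image inj_on_def)
  then show ?thesis by (simp add: r_num_def set_diff_eq)
qed

text \<open>
  The condition that keeps, for each double word in the set, enough earlier ones to produce all its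
  \<open>colon_vars\<close>: the variable \<open>s_k\<close> with \<open>k \<notin> I\<close> comes from \<open>w(I \<union> {k}, k)\<close>, and \<open>t_k\<close> with \<open>k \<in> I\<close>,
  \<open>k < i\<close> from \<open>w(I, k)\<close>.
\<close>

definition up_closed :: "nat \<Rightarrow> (nat set \<times> nat) set \<Rightarrow> bool" where
  "up_closed m X \<longleftrightarrow> (\<forall>(I, i)\<in>X. (\<forall>k\<in>{1..m} - I. (insert k I, k) \<in> X) \<and> (\<forall>k\<in>I. k < i \<longrightarrow> (I, k) \<in> X))"

lemma up_closedD:
  assumes "up_closed m X" "(I, i) \<in> X"
  shows "k \<in> {1..m} - I \<Longrightarrow> (insert k I, k) \<in> X" "k \<in> I \<Longrightarrow> k < i \<Longrightarrow> (I, k) \<in> X"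
  using assms unfolding up_closed_def by blast+

text \<open>
  Orders by decreasing size of \<open>I\<close>, then by increasing \<open>i\<close>: as \<open>i \<le> m < m + 1\<close>, the first summand
  dominates. Different sets of the same size may share a position, which is harmless because neither
  contains the other.
\<close>

definition position :: "nat \<Rightarrow> nat set \<times> nat \<Rightarrow> nat" where
  "position m x = (m - card (fst x)) * (m + 1) + snd x"

lemma position_le:
  assumes "(J, k) \<in> marked_subsets m" "(I, i) \<in> marked_subsets m" "position m (J, k) \<le> position m (I, i)"
  shows "card I \<le> card J" "card I = card J \<Longrightarrow> k \<le> i"
proof -
  have b: "i \<le> m" "k \<le> m" "card I \<le> m" "card J \<le> m"
    using assms(1,2) card_mono[of "{1..m}" I] card_mono[of "{1..m}" J]
    by (auto simp: marked_subsets_def)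
  show "card I \<le> card J"
  proof (rule ccontr)
    assume "\<not> card I \<le> card J"
    then have "Suc (m - card I) \<le> m - card J" using b by linarith
    then have "Suc (m - card I) * (m + 1) \<le> (m - card J) * (m + 1)" by (rule mult_le_mono1)
    then show False using assms(3) b by (simp add: position_def)
  qed
  show "k \<le> i" if "card I = card J"
    using assms(3) that by (simp add: position_def)
qed

lemma position_less:
  assumes "(I, i) \<in> marked_subsets m" "k \<in> {1..m} - I"
  shows "position m (insert k I, k) < position m (I, i)"
proof (rule ccontr)
  assume "\<not> ?thesis"
  then have "position m (I, i) \<le> position m (insert k I, k)" by simp
  moreover have "(insert k I, k) \<in> marked_subsets m" using assms by (auto simp: marked_subsets_def)
  ultimately have "card (insert k I) \<le> card I" using position_le(1) assms(1) by blast
  moreover have "finite I" using assms(1) by (auto simp: marked_subsets_def intro: finite_subset)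
  ultimately show False using assms(2) by simp
qed

text \<open>
  An earlier word \<open>w(J, k)\<close> either has an \<open>s_l\<close> with \<open>l \<in> J - I\<close>, which \<open>w(I, i)\<close> lacks; or \<open>J \<subseteq> I\<close>,
  and then \<open>J = I\<close> by size, \<open>k < i\<close>, and \<open>t_k\<close> is the missing letter. Conversely each such variable
  times \<open>w(I, i)\<close> is a multiple of the word that \<open>up_closed\<close> provides.
\<close>

lemma colon_double_word:
  assumes X: "insert (I, i) X \<subseteq> marked_subsets m" "up_closed m (insert (I, i) X)" "(I, i) \<notin> X"
    and last: "\<And>y. y \<in> X \<Longrightarrow> position m y \<le> position m (I, i)"
  shows "(\<exists>h\<in>double_word m ` X. mon_divides h (double_word m (I, i) + e)) \<longleftrightarrow>
    (\<exists>h\<in>(\<lambda>v. single v 1) ` colon_vars m (I, i). mon_divides h e)" (is "?L \<longleftrightarrow> ?R")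
proof
  have dv: "mon_divides (single v (Suc 0)) e \<longleftrightarrow> lookup e v \<noteq> 0" for v
    by (auto simp: mon_divides_def lookup_single when_def)
  have Ii: "I \<subseteq> {1..m}" "i \<in> I" using X(1) by (auto simp: marked_subsets_def)
  {
    assume ?L
    then obtain J k where J: "(J, k) \<in> X" "mon_divides (double_word m (J, k)) (double_word m (I, i) + e)"
      by auto
    have Jk: "J \<subseteq> {1..m}" "k \<in> J" using J(1) X(1) by (auto simp: marked_subsets_def)
    have le: "lookup (double_word m (J, k)) v \<le> lookup (double_word m (I, i)) v + lookup e v" for v
      using J(2) by (simp add: mon_divides_def lookup_add)
    show ?R
    proof (cases "J \<subseteq> I")
      case False
      then obtain l where "l \<in> J" "l \<notin> I" by blast
      then have "Sv l \<in> colon_vars m (I, i)" "lookup e (Sv l) \<noteq> 0"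
        using le[of "Sv l"] Jk by (auto simp: colon_vars_def lookup_double_word)
      then show ?thesis by (auto simp: dv)
    next
      case True
      have fin: "finite I" using Ii finite_subset by blast
      have p: "position m (J, k) \<le> position m (I, i)" using last J(1) by blast
      have mem: "(J, k) \<in> marked_subsets m" "(I, i) \<in> marked_subsets m" using X(1) J(1) by auto
      have "J = I" using position_le(1)[OF mem p] True fin by (meson card_seteq)
      moreover then have "k \<le> i" using position_le(2)[OF mem p] by simp
      moreover have "k \<noteq> i" using J(1) X(3) \<open>J = I\<close> by auto
      ultimately have "Tv k \<in> colon_vars m (I, i)" "lookup e (Tv k) \<noteq> 0"
        using le[of "Tv k"] Jk by (auto simp: colon_vars_def lookup_double_word)
      then show ?thesis by (auto simp: dv)
    qed
  }
  {
    assume ?R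
    then obtain v where v: "v \<in> colon_vars m (I, i)" "lookup e v \<noteq> 0" by (auto simp: dv)
    then consider k where "v = Sv k" "k \<in> {1..m} - I" | k where "v = Tv k" "k \<in> I" "k < i"
      by (auto simp: colon_vars_def)
    then show ?L
    proof cases
      case 1
      then have "(insert k I, k) \<in> X" using X(2) by (auto simp: up_closed_def)
      moreover have "mon_divides (double_word m (insert k I, k)) (double_word m (I, i) + e)"
        unfolding mon_divides_def
      proof
        fix w show "lookup (double_word m (insert k I, k)) w \<le> lookup (double_word m (I, i) + e) w"
          using 1 v(2) by (cases w) (auto simp: lookup_add lookup_double_word)
      qed
      ultimately show ?thesis by blast
    next
      case 2
      then have "(I, k) \<in> X" using X(2) by (auto simp: up_closed_def)
      moreover have "mon_divides (double_word m (I, k)) (double_word m (I, i) + e)"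
        unfolding mon_divides_def
      proof
        fix w show "lookup (double_word m (I, k)) w \<le> lookup (double_word m (I, i) + e) w"
          using 2 v(2) by (cases w) (auto simp: lookup_add lookup_double_word)
      qed
      ultimately show ?thesis by blast
    qed
  }
qed

text \<open>
  Induction on \<open>X\<close>, removing a double word of largest position. What remains is still \<open>up_closed\<close>,
  since this condition asks, for each word, only for words of smaller position.
\<close>

lemma linear_quotients_resolution:
  assumes "finite X" "m \<le> n" "X \<subseteq> marked_subsets m" "up_closed m X"
  shows "\<exists>d. linear_resolution n (m + 1)
    (aug_rank (\<lambda>l. \<Sum>x\<in>X. card (colon_vars m x) choose l)) d
    (mon_ideal n (double_word m ` X) :: 'k::field cut_poly set)"
  using assms(1,3,4)
proof (induction X rule: finite_ranking_induct[where f = "position m"])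
  case empty
  have r: "(aug_rank (\<lambda>l. \<Sum>x\<in>{}. card (colon_vars m x) choose l))
      = (\<lambda>j. if j = 0 then 1 else 0)"
    by (auto simp: fun_eq_iff aug_rank_def split: nat.splits)
  show ?case unfolding r image_empty using linear_resolution_empty by blast
next
  case (insert x X)
  show ?case
  proof (cases "x \<in> X")
    case True
    then show ?thesis using insert by (simp add: insert_absorb)
  next
    case False
    obtain I i where x: "x = (I, i)" by force
    have xm: "x \<in> marked_subsets m" using insert.prems by simp
    have "up_closed m X"
      unfolding up_closed_def
    proof clarify
      fix J k assume J: "(J, k) \<in> X"
      then have Jm: "(J, k) \<in> marked_subsets m" using insert.prems by auto
      have p: "position m (J, k) \<le> position m x" using insert.hyps J by blast
      have "(insert l J, l) \<in> X" if l: "l \<in> {1..m} - J" for l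
      proof -
        have "(insert l J, l) \<in> insert x X" using up_closedD(1)[OF insert.prems(2)] J l by blast
        moreover have "(insert l J, l) \<noteq> x" using position_less[OF Jm l] p by auto
        ultimately show ?thesis by simp
      qed
      moreover have "(J, l) \<in> X" if l: "l \<in> J" "l < k" for l
      proof -
        have "(J, l) \<in> insert x X" using up_closedD(2)[OF insert.prems(2)] J l by blast
        moreover have "(J, l) \<noteq> x" using l p by (auto simp: position_def)
        ultimately show ?thesis by simp
      qed
      ultimately show "(\<forall>l\<in>{1..m} - J. (insert l J, l) \<in> X) \<and> (\<forall>l\<in>J. l < k \<longrightarrow> (J, l) \<in> X)" by blast
    qed
    then obtain dP where dP: "linear_resolution n (mon_degree n (double_word m x))
        (aug_rank (\<lambda>l. \<Sum>x\<in>X. card (colon_vars m x) choose l)) dP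
        (mon_ideal n (double_word m ` X) :: 'k cut_poly set)"
      using insert mon_degree_double_word[OF assms(2) xm] by auto
    have cv: "finite (colon_vars m x)" "colon_vars m x \<subseteq> var_set n"
      using xm assms(2) by (auto simp: colon_vars_def var_set_def marked_subsets_def intro: finite_subset)
    obtain dQ where dQ: "linear_resolution n 1 (\<lambda>j. card (colon_vars m x) choose j) dQ
        (mon_ideal n ((\<lambda>v. single v 1) ` colon_vars m x) :: 'k cut_poly set)"
      using koszul_resolution[OF cv] by blast
    have colon: "(\<exists>h\<in>double_word m ` X. mon_divides h (double_word m x + e)) \<longleftrightarrow>
        (\<exists>h\<in>(\<lambda>v. single v 1) ` colon_vars m x. mon_divides h e)" for e
      using colon_double_word[of I i X m e] insert.prems insert.hyps False by (simp add: x)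
    have rank: "cone_rank (aug_rank (\<lambda>l. \<Sum>x\<in>X. card (colon_vars m x) choose l))
        (\<lambda>j. card (colon_vars m x) choose j)
      = (aug_rank (\<lambda>l. \<Sum>x\<in>insert x X. card (colon_vars m x) choose l))"
      using False insert.hyps by (auto simp: fun_eq_iff cone_rank_def aug_rank_def split: nat.splits)
    show ?thesis
      using linear_resolution_insert[OF dP dQ keys_double_word[OF assms(2) xm] colon]
      unfolding rank mon_degree_double_word[OF assms(2) xm] by simp
  qed
qed

lemma double_words_resolution:
  fixes n :: nat
  shows "\<exists>d. linear_resolution n (n - 1 + 1)
    (aug_rank (\<lambda>l. \<Sum>I\<in>{I. I \<noteq> {} \<and> I \<subseteq> {1..n - 1}}. \<Sum>i\<in>I. r_num n I i choose l)) d
    (mon_ideal n (double_word (n - 1) ` marked_subsets (n - 1)) :: 'k::field cut_poly set)"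
proof -
  have "up_closed (n - 1) (marked_subsets (n - 1))"
    by (auto simp: up_closed_def marked_subsets_def)
  moreover have "(\<Sum>x\<in>marked_subsets (n - 1). card (colon_vars (n - 1) x) choose l)
      = (\<Sum>I\<in>{I. I \<noteq> {} \<and> I \<subseteq> {1..n - 1}}. \<Sum>i\<in>I. r_num n I i choose l)" for l
  proof -
    have "(\<Sum>x\<in>marked_subsets (n - 1). card (colon_vars (n - 1) x) choose l)
        = (\<Sum>I\<in>Pow {1..n - 1}. \<Sum>i\<in>I. card (colon_vars (n - 1) (I, i)) choose l)"
      unfolding marked_subsets_def by (subst sum.Sigma) (auto intro: finite_subset)
    also have "\<dots> = (\<Sum>I\<in>Pow {1..n - 1}. \<Sum>i\<in>I. r_num n I i choose l)"
      by (intro sum.cong) (auto simp: card_colon_vars[unfolded One_nat_def])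
    also have "\<dots> = (\<Sum>I\<in>{I. I \<noteq> {} \<and> I \<subseteq> {1..n - 1}}. \<Sum>i\<in>I. r_num n I i choose l)"
      by (rule sum.mono_neutral_right) auto
    finally show ?thesis .
  qed
  ultimately show ?thesis
    using linear_quotients_resolution[OF finite_marked_subsets, of "n - 1" n "n - 1"] by simp
qed

section \<open>The intersection of the two cut ideals\<close>

lemma poly_ring_simps:
  "carrier (poly_ring n) = poly_set n" "mult (poly_ring n) = (*)" "one (poly_ring n) = 1"
  "zero (poly_ring n) = 0" "add (poly_ring n) = (+)"
  by (simp_all add: poly_ring_def poly_set_def var_set_def)

lemma cring_poly_ring: "cring (poly_ring n :: 'k::field cut_poly ring)"
proof (rule cringI)
  show "abelian_group (poly_ring n :: 'k cut_poly ring)"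
    by (rule abelian_groupI)
      (auto simp: poly_ring_simps poly.add_closed poly.zero_closed add_ac
        intro!: bexI[of _ "- x" for x] poly.uminus_closed)
  show "comm_monoid (poly_ring n :: 'k cut_poly ring)"
    by (rule comm_monoidI) (auto simp: poly_ring_simps poly.mult_closed poly.one_closed mult_ac)
qed (auto simp: poly_ring_simps distrib_right)

lemma mon_ideal_add: "p \<in> mon_ideal n G \<Longrightarrow> q \<in> mon_ideal n G \<Longrightarrow> p + q \<in> mon_ideal n G"
  using keys_add[of p q] by (auto simp: mon_ideal_def poly.add_closed)

lemma mon_ideal_mult:
  assumes "p \<in> mon_ideal n G" "q \<in> poly_set n" shows "q * p \<in> mon_ideal n G"
proof -
  have "\<exists>g\<in>G. mon_divides g m" if m: "m \<in> keys (q * p)" for m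
  proof -
    obtain a b where "b \<in> keys p" "m = a + b" using m by (blast elim: keys_mult_elim)
    moreover then obtain g where "g \<in> G" "mon_divides g b" using assms by (auto simp: mon_ideal_def)
    ultimately show ?thesis
      by (auto simp: mon_divides_def lookup_add intro!: bexI[of _ g] trans_le_add2)
  qed
  then show ?thesis using assms by (simp add: mon_ideal_def poly.mult_closed)
qed

lemma zero_mon_ideal: "0 \<in> mon_ideal n G"
  by (simp add: mon_ideal_def poly.zero_closed)

lemma ideal_mon_ideal: "ideal (mon_ideal n G :: 'k::field cut_poly set) (poly_ring n)"
proof -
  interpret cring "poly_ring n :: 'k cut_poly ring" by (rule cring_poly_ring)
  have uminus: "- p \<in> mon_ideal n G" if "p \<in> mon_ideal n G" for p :: "'k cut_poly"
    using that by (simp add: mon_ideal_def poly.uminus_closed)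
  have inv: "\<ominus>\<^bsub>poly_ring n\<^esub> p = - p" if "p \<in> poly_set n" for p :: "'k cut_poly"
    by (rule minus_equality) (use that in \<open>auto simp: poly_ring_simps poly.uminus_closed\<close>)
  show ?thesis
  proof (rule idealI)
    show "ring (poly_ring n :: 'k cut_poly ring)" by (rule ring_axioms)
    show "subgroup (mon_ideal n G :: 'k cut_poly set) (add_monoid (poly_ring n))"
    proof (rule add.subgroupI)
      show "mon_ideal n G \<subseteq> carrier (poly_ring n :: 'k cut_poly ring)"
        by (auto simp: mon_ideal_def poly_ring_simps)
      show "mon_ideal n G \<noteq> ({} :: 'k cut_poly set)" using zero_mon_ideal by blast
      show "\<ominus>\<^bsub>poly_ring n\<^esub> p \<in> mon_ideal n G" if "p \<in> mon_ideal n G" for p :: "'k cut_poly"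
        using that uminus[OF that] inv[of p] by (simp add: mon_ideal_def)
      show "p \<oplus>\<^bsub>poly_ring n\<^esub> q \<in> mon_ideal n G" if "p \<in> mon_ideal n G" "q \<in> mon_ideal n G"
        for p q :: "'k cut_poly"
        using that by (simp add: poly_ring_simps mon_ideal_add)
    qed
    show "p \<otimes>\<^bsub>poly_ring n\<^esub> q \<in> mon_ideal n G" "q \<otimes>\<^bsub>poly_ring n\<^esub> p \<in> mon_ideal n G"
      if "p \<in> mon_ideal n G" "q \<in> carrier (poly_ring n)" for p q :: "'k cut_poly"
      using mon_ideal_mult[of p n G q] that by (simp_all add: poly_ring_simps mult.commute)
  qed
qed

lemma genideal_monomials:
  assumes G: "\<And>g. g \<in> G \<Longrightarrow> keys g \<subseteq> var_set n"
  shows "Idl\<^bsub>poly_ring n\<^esub> ((\<lambda>g. single g 1) ` G) = (mon_ideal n G :: 'k::field cut_poly set)"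
proof
  interpret cring "poly_ring n :: 'k cut_poly ring" by (rule cring_poly_ring)
  let ?M = "(\<lambda>g. single g 1) ` G :: 'k cut_poly set"
  have M: "?M \<subseteq> carrier (poly_ring n)"
    by (auto simp: poly_ring_simps poly_set_def dest: subsetD[OF G])
  show "Idl\<^bsub>poly_ring n\<^esub> ?M \<subseteq> mon_ideal n G"
  proof (rule genideal_minimal[OF ideal_mon_ideal], clarify)
    fix g assume "g \<in> G"
    with G[OF this] show "single g 1 \<in> (mon_ideal n G :: 'k cut_poly set)"
      by (auto simp: mon_ideal_def poly_set_def mon_divides_def intro!: bexI[of _ g])
  qed
  interpret I: ideal "Idl\<^bsub>poly_ring n\<^esub> ?M" "poly_ring n" by (rule genideal_ideal[OF M])
  show "mon_ideal n G \<subseteq> Idl\<^bsub>poly_ring n\<^esub> ?M"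
  proof
    fix p :: "'k cut_poly" assume p: "p \<in> mon_ideal n G"
    have term_in: "single m (lookup p m) \<in> Idl\<^bsub>poly_ring n\<^esub> ?M" if m: "m \<in> keys p" for m
    proof -
      obtain g where g: "g \<in> G" "mon_divides g m" using p m by (auto simp: mon_ideal_def)
      obtain h where h: "m = g + h" using g(2) by (auto simp: mon_divides_iff)
      have "keys m \<subseteq> var_set n" using p m by (auto simp: mon_ideal_def poly_set_def)
      then have "single h (lookup p m) \<in> carrier (poly_ring n)"
        by (auto simp: poly_ring_simps poly_set_def h keys_add_nat split: if_splits)
      moreover have "single g 1 \<in> Idl\<^bsub>poly_ring n\<^esub> ?M" using genideal_self[OF M] g by blast
      ultimately have "single g 1 \<otimes>\<^bsub>poly_ring n\<^esub> single h (lookup p m) \<in> Idl\<^bsub>poly_ring n\<^esub> ?M"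
        by (rule I.I_r_closed[rotated])
      then show ?thesis by (simp add: poly_ring_simps mult_single h)
    qed
    have partial: "(\<Sum>m\<in>A. single m (lookup p m)) \<in> Idl\<^bsub>poly_ring n\<^esub> ?M" if "finite A" "A \<subseteq> keys p" for A
      using that
    proof (induction A)
      case empty
      then show ?case using I.zero_closed by (simp add: poly_ring_simps)
    next
      case (insert m A)
      then show ?case using I.a_closed[OF term_in[of m], of "\<Sum>m\<in>A. single m (lookup p m)"]
        by (simp add: poly_ring_simps)
    qed
    have "(\<Sum>m\<in>keys p. single m (lookup p m)) = p"
      by (rule poly_mapping_eqI) (auto simp: lookup_sum lookup_single when_def in_keys_iff)
    then show "p \<in> Idl\<^bsub>poly_ring n\<^esub> ?M" using partial[OF finite_keys subset_refl] by simp
  qed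
qed

definition cut_edges :: "nat \<Rightarrow> nat set \<Rightarrow> nat set" where
  "cut_edges k A = {i \<in> {1..k}. card (cycle_edge k i \<inter> A) = 1}"

lemma cut_monomial_word: "(cut_monomial k A :: 'k::field cut_poly) = single (word k (cut_edges k A)) 1"
proof -
  have prod: "(\<Prod>i\<in>B. single (f i) (1 :: 'k)) = single (\<Sum>i\<in>B. f i) 1" if "finite B"
    for B and f :: "nat \<Rightarrow> cut_var \<Rightarrow>\<^sub>0 nat"
    using that by (induction B) (auto simp: mult_single)
  have "(cut_monomial k A :: 'k cut_poly) = single (\<Sum>i\<in>{1..k}. single (if card (cycle_edge k i \<inter> A) = 1 then Sv i else Tv i) 1) 1"
    unfolding cut_monomial_def pvar_def by (rule prod) simp
  also have "(\<Sum>i\<in>{1..k}. single (if card (cycle_edge k i \<inter> A) = 1 then Sv i else Tv i) 1) = word k (cut_edges k A)"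
    unfolding word_def by (intro sum.cong) (auto simp: cut_edges_def)
  finally show ?thesis .
qed

lemma card_pair_Int: "a \<noteq> b \<Longrightarrow> card ({a, b} \<inter> A) = 1 \<longleftrightarrow> (a \<in> A) \<noteq> (b \<in> A)"
  by (cases "a \<in> A"; cases "b \<in> A") (auto simp: Int_insert_left)

lemma mem_cut_edges:
  assumes "k \<ge> 3"
  shows "i \<in> cut_edges k A \<longleftrightarrow> i \<in> {1..k} \<and>
    (if i < k then (i \<in> A) \<noteq> (i + 1 \<in> A) else (1 \<in> A) \<noteq> (k \<in> A))"
  using assms by (auto simp: cut_edges_def cycle_edge_def card_pair_Int[unfolded One_nat_def])

text \<open>Along the path from \<open>1\<close> to \<open>k\<close> every change flips the membership in \<open>A\<close>.\<close>

lemma odd_card_changes: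
  "odd (card {i \<in> {1..<k}. (i \<in> A) \<noteq> (i + 1 \<in> A)}) \<longleftrightarrow> (1 \<in> A) \<noteq> (k \<in> A)" if "k \<ge> 1" for k :: nat
  using that
proof (induction k rule: dec_induct)
  case (step k)
  have "{i \<in> {1..<Suc k}. (i \<in> A) \<noteq> (i + 1 \<in> A)} =
      (if (k \<in> A) \<noteq> (k + 1 \<in> A) then insert k {i \<in> {1..<k}. (i \<in> A) \<noteq> (i + 1 \<in> A)}
       else {i \<in> {1..<k}. (i \<in> A) \<noteq> (i + 1 \<in> A)})"
    using step.hyps by (auto simp: less_Suc_eq)
  then show ?case using step.IH by auto
qed simp

text \<open>
  The closing edge \<open>{1, k}\<close> makes the number of changes around the cycle even. Conversely, an even
  set \<open>E\<close> of edges is cut by the vertices before which an odd number of edges of \<open>E\<close> occur.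
\<close>

lemma cut_edges_range:
  assumes "k \<ge> 3"
  shows "cut_edges k ` Pow {1..k} = {E. E \<subseteq> {1..k} \<and> even (card E)}"
proof (intro equalityI subsetI)
  fix E assume "E \<in> cut_edges k ` Pow {1..k}"
  then obtain A where E: "E = cut_edges k A" by blast
  have "E = (if (1 \<in> A) \<noteq> (k \<in> A) then insert k {i \<in> {1..<k}. (i \<in> A) \<noteq> (i + 1 \<in> A)}
      else {i \<in> {1..<k}. (i \<in> A) \<noteq> (i + 1 \<in> A)})"
    using assms by (auto simp: E mem_cut_edges[OF assms] split: if_splits)
  then have "even (card E)" using odd_card_changes[of k A] assms by auto
  then show "E \<in> {E. E \<subseteq> {1..k} \<and> even (card E)}" by (auto simp: E cut_edges_def)
next
  fix E assume "E \<in> {E. E \<subseteq> {1..k} \<and> even (card E)}"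
  then have E: "E \<subseteq> {1..k}" "even (card E)" by auto
  have fin: "finite E" using E finite_subset by blast
  define A where "A = {i \<in> {1..k}. odd (card (E \<inter> {..<i}))}"
  have st: "(i \<in> A) \<noteq> (i + 1 \<in> A) \<longleftrightarrow> i \<in> E" if "i \<in> {1..<k}" for i
  proof -
    have "E \<inter> {..<i + 1} = (if i \<in> E then insert i (E \<inter> {..<i}) else E \<inter> {..<i})"
      by (auto simp: less_Suc_eq)
    then show ?thesis using that fin by (auto simp: A_def)
  qed
  have "E \<inter> {..<1} = {}" using E(1) by (auto simp: subset_iff)
  then have "1 \<notin> A" by (simp add: A_def)
  moreover have "k \<in> A \<longleftrightarrow> k \<in> E"
  proof -
    have "E = (if k \<in> E then insert k (E \<inter> {..<k}) else E \<inter> {..<k})"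
      using E(1) by (auto simp: subset_iff le_less)
    then have "even (card (if k \<in> E then insert k (E \<inter> {..<k}) else E \<inter> {..<k}))"
      using E(2) by simp
    then show ?thesis using fin assms by (auto simp: A_def split: if_splits)
  qed
  ultimately have last: "(1 \<in> A) \<noteq> (k \<in> A) \<longleftrightarrow> k \<in> E" by blast
  have "cut_edges k A = E"
  proof (unfold set_eq_iff, rule allI)
    fix i
    consider "i \<notin> {1..k}" | "i \<in> {1..<k}" | "i = k" "i \<in> {1..k}" by fastforce
    then show "i \<in> cut_edges k A \<longleftrightarrow> i \<in> E"
    proof cases
      case 1
      then show ?thesis using E(1) by (auto simp: mem_cut_edges[OF assms])
    next
      case 2
      then show ?thesis using st[OF 2] by (simp add: mem_cut_edges[OF assms])
    next
      case 3
      then show ?thesis using last by (simp add: mem_cut_edges[OF assms])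
    qed
  qed
  then show "E \<in> cut_edges k ` Pow {1..k}" by (auto simp: A_def)
qed

lemma cut_ideal_eq:
  assumes "k \<ge> 3" "k \<le> n"
  shows "cut_ideal n k = (mon_ideal n (word k ` {E. E \<subseteq> {1..k} \<and> even (card E)}) :: 'k::field cut_poly set)"
proof -
  have gen: "{cut_monomial k A | A. A \<subseteq> {1..k}} =
      (\<lambda>g. single g (1::'k)) ` word k ` {E. E \<subseteq> {1..k} \<and> even (card E)}"
    unfolding cut_edges_range[OF assms(1), symmetric] by (auto simp: cut_monomial_word)
  show ?thesis
    unfolding cut_ideal_def gen by (rule genideal_monomials) (use keys_word[OF assms(2)] in blast)
qed

text \<open>The renaming of monomials inside \<open>exchange\<close>.\<close>

definition swap_exponent :: "nat \<Rightarrow> (cut_var \<Rightarrow>\<^sub>0 nat) \<Rightarrow> cut_var \<Rightarrow>\<^sub>0 nat" where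
  "swap_exponent k = Poly_Mapping.map_key (Transposition.transpose (Sv k) (Tv k))"

lemma lookup_swap_exponent: "lookup (swap_exponent k e) v = lookup e (Transposition.transpose (Sv k) (Tv k) v)"
  by (simp add: swap_exponent_def map_key.rep_eq[OF inj_transpose])

lemma swap_exponent_invol [simp]: "swap_exponent k (swap_exponent k e) = e"
  by (rule poly_mapping_eqI) (simp add: lookup_swap_exponent)

lemma inj_swap_exponent: "inj (swap_exponent k)"
  by (metis injI swap_exponent_invol)

lemma lookup_exchange: "lookup (exchange k p) m = lookup p (swap_exponent k m)"
  using inj_swap_exponent[of k] by (simp add: exchange_def swap_exponent_def[symmetric] map_key.rep_eq)

lemma exchange_invol: "exchange k (exchange k p) = p"
  by (rule poly_mapping_eqI) (simp add: lookup_exchange)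

lemma mem_keys_exchange: "m \<in> keys (exchange k p) \<longleftrightarrow> swap_exponent k m \<in> keys p"
  by (simp add: in_keys_iff lookup_exchange)

lemma keys_swap_exponent:
  assumes "k \<in> {1..n}" "keys e \<subseteq> var_set n" shows "keys (swap_exponent k e) \<subseteq> var_set n"
proof
  fix v assume "v \<in> keys (swap_exponent k e)"
  then have "Transposition.transpose (Sv k) (Tv k) v \<in> var_set n"
    using assms(2) by (auto simp: in_keys_iff lookup_swap_exponent)
  then show "v \<in> var_set n"
    using assms(1) by (auto simp: var_set_def Transposition.transpose_def split: if_splits)
qed

lemma mon_divides_swap: "mon_divides (swap_exponent k g) m \<longleftrightarrow> mon_divides g (swap_exponent k m)"
  unfolding mon_divides_def lookup_swap_exponent by (metis transpose_involutory)

lemma exchange_mon_ideal: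
  assumes k: "k \<in> {1..n}"
  shows "exchange k ` mon_ideal n G = (mon_ideal n (swap_exponent k ` G) :: 'k::field cut_poly set)"
proof -
  have "exchange k p \<in> mon_ideal n (swap_exponent k ` G)" if "p \<in> mon_ideal n G" for p :: "'k cut_poly" and G
    using that keys_swap_exponent[OF k, of "swap_exponent k m" for m]
    by (auto simp: mon_ideal_def poly_set_def mem_keys_exchange mon_divides_swap)
  note sub = this
  have "p \<in> exchange k ` mon_ideal n G" if p: "p \<in> mon_ideal n (swap_exponent k ` G)" for p :: "'k cut_poly"
    using sub[OF p] exchange_invol[of k p] by (force simp: image_image)
  with sub show ?thesis by blast
qed

lemma swap_exponent_word:
  assumes "k \<ge> 1"
  shows "swap_exponent k (word k E) = word k (if k \<in> E then E - {k} else insert k E)"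
proof (rule poly_mapping_eqI)
  fix v show "lookup (swap_exponent k (word k E)) v
      = lookup (word k (if k \<in> E then E - {k} else insert k E)) v"
    using assms by (cases v) (auto simp: lookup_swap_exponent Transposition.transpose_def lookup_word)
qed

text \<open>Exchanging \<open>s_k\<close> and \<open>t_k\<close> adds or removes \<open>k\<close> and thereby flips the parity.\<close>

lemma swap_even_words:
  assumes "k \<ge> 1"
  shows "swap_exponent k ` word k ` {E. E \<subseteq> {1..k} \<and> even (card E)} = word k ` {E. E \<subseteq> {1..k} \<and> odd (card E)}"
proof -
  define f where "f E = (if k \<in> E then E - {k} else insert k E)" for E
  have ff: "f (f E) = E" for E by (auto simp: f_def)
  have f: "f E \<subseteq> {1..k} \<and> (even (card (f E)) \<longleftrightarrow> odd (card E))" if "E \<subseteq> {1..k}" for E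
  proof -
    have fin: "finite E" using that finite_subset by blast
    show ?thesis
    proof (cases "k \<in> E")
      case True
      have "card E = Suc (card (E - {k}))" by (rule card_Suc_Diff1[symmetric, OF fin True])
      then have "even (card (E - {k})) \<longleftrightarrow> odd (card E)" by simp
      then show ?thesis using True that by (auto simp: f_def)
    qed (use fin that assms in \<open>auto simp: f_def\<close>)
  qed
  have "f ` {E. E \<subseteq> {1..k} \<and> even (card E)} = {E. E \<subseteq> {1..k} \<and> odd (card E)}"
  proof (intro equalityI subsetI)
    fix E assume "E \<in> {E. E \<subseteq> {1..k} \<and> odd (card E)}"
    then show "E \<in> f ` {E. E \<subseteq> {1..k} \<and> even (card E)}"
      using f[of E] ff[of E] by (metis (mono_tags, lifting) image_eqI mem_Collect_eq)
  qed (use f in auto)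
  moreover have "swap_exponent k ` word k ` {E. E \<subseteq> {1..k} \<and> even (card E)} =
      word k ` f ` {E. E \<subseteq> {1..k} \<and> even (card E)}"
    unfolding image_image by (intro image_cong refl) (simp only: swap_exponent_word[OF assms] f_def)
  ultimately show ?thesis by simp
qed

lemma mon_divides_word:
  "mon_divides (word m E) x \<longleftrightarrow>
    (\<forall>k\<in>{1..m}. (k \<in> E \<longrightarrow> lookup x (Sv k) \<ge> 1) \<and> (k \<notin> E \<longrightarrow> lookup x (Tv k) \<ge> 1))"
proof
  assume d: "mon_divides (word m E) x"
  show "\<forall>k\<in>{1..m}. (k \<in> E \<longrightarrow> lookup x (Sv k) \<ge> 1) \<and> (k \<notin> E \<longrightarrow> lookup x (Tv k) \<ge> 1)"
  proof
    fix k assume k: "k \<in> {1..m}"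
    show "(k \<in> E \<longrightarrow> lookup x (Sv k) \<ge> 1) \<and> (k \<notin> E \<longrightarrow> lookup x (Tv k) \<ge> 1)"
      using d[unfolded mon_divides_def, rule_format, of "Sv k"]
        d[unfolded mon_divides_def, rule_format, of "Tv k"] k by (auto simp: lookup_word)
  qed
next
  assume r: "\<forall>k\<in>{1..m}. (k \<in> E \<longrightarrow> lookup x (Sv k) \<ge> 1) \<and> (k \<notin> E \<longrightarrow> lookup x (Tv k) \<ge> 1)"
  show "mon_divides (word m E) x"
    unfolding mon_divides_def
  proof
    fix v show "lookup (word m E) v \<le> lookup x v"
      using r by (cases v) (auto simp: lookup_word)
  qed
qed

text \<open>The double word \<open>w(I, i)\<close> is the least common multiple of the words of \<open>I\<close> and of \<open>I - {i}\<close>.\<close>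

lemma mon_divides_double_word:
  assumes "I \<subseteq> {1..m}" "i \<in> I"
  shows "mon_divides (double_word m (I, i)) x \<longleftrightarrow>
    mon_divides (word m I) x \<and> mon_divides (word m (I - {i})) x"
proof
  assume d: "mon_divides (double_word m (I, i)) x"
  have "mon_divides (word m I) (double_word m (I, i))"
    by (auto simp: double_word_def mon_divides_iff)
  moreover have "mon_divides (word m (I - {i})) (double_word m (I, i))"
    using assms by (auto simp: mon_divides_word lookup_double_word)
  ultimately show "mon_divides (word m I) x \<and> mon_divides (word m (I - {i})) x"
    using d unfolding mon_divides_def by (meson order_trans)
next
  assume r: "mon_divides (word m I) x \<and> mon_divides (word m (I - {i})) x"
  show "mon_divides (double_word m (I, i)) x"
    unfolding mon_divides_def
  proof
    fix v show "lookup (double_word m (I, i)) v \<le> lookup x v"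
      using r[unfolded mon_divides_word] assms by (cases v) (auto simp: lookup_double_word)
  qed
qed

text \<open>
  Words of different parity differ at some \<open>i\<close>, where a common multiple has both letters; and the two
  words whose least common multiple is \<open>w(I, i)\<close> have different parity.
\<close>

lemma both_parities_iff_double_word:
  "(\<exists>E F. E \<subseteq> {1..m} \<and> even (card E) \<and> F \<subseteq> {1..m} \<and> odd (card F) \<and>
      mon_divides (word m E) x \<and> mon_divides (word m F) x) \<longleftrightarrow>
    (\<exists>y\<in>marked_subsets m. mon_divides (double_word m y) x)" (is "?L \<longleftrightarrow> ?R")
proof
  assume ?L
  then obtain E F where EF: "E \<subseteq> {1..m}" "F \<subseteq> {1..m}" "even (card E)" "odd (card F)"
    "mon_divides (word m E) x" "mon_divides (word m F) x" by blast
  then have "E \<noteq> F" by auto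
  then obtain i where i: "i \<in> E \<and> i \<notin> F \<or> i \<in> F \<and> i \<notin> E" by blast
  define I where "I = insert i E"
  have I: "I \<subseteq> {1..m}" "i \<in> I" using EF i by (auto simp: I_def)
  have "mon_divides (word m I) x \<and> mon_divides (word m (I - {i})) x"
    using EF(5,6) i by (auto simp: mon_divides_word I_def)
  then show ?R
    using mon_divides_double_word[OF I] I by (force simp: marked_subsets_def)
next
  assume ?R
  then obtain I i where I: "I \<subseteq> {1..m}" "i \<in> I" "mon_divides (double_word m (I, i)) x"
    by (auto simp: marked_subsets_def)
  have d: "mon_divides (word m I) x" "mon_divides (word m (I - {i})) x"
    using I mon_divides_double_word by blast+
  have "finite I" using I finite_subset by blast
  then have "card I = Suc (card (I - {i}))" by (rule card_Suc_Diff1[symmetric, OF _ I(2)])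
  then have "even (card I) \<longleftrightarrow> odd (card (I - {i}))" by simp
  moreover have "I - {i} \<subseteq> {1..m}" using I by auto
  ultimately show ?L using d I(1) by (cases "even (card I)") blast+
qed

lemma L_ideal_eq:
  assumes "n \<ge> 4"
  shows "L_ideal n = (mon_ideal n (double_word (n - 1) ` marked_subsets (n - 1)) :: 'k::field cut_poly set)"
proof -
  let ?W = "\<lambda>P. word (n - 1) ` {E. E \<subseteq> {1..n - 1} \<and> P (card E)}"
  have k: "n - 1 \<ge> 3" "n - 1 \<le> n" "n - 1 \<in> {1..n}" "n - 1 \<ge> 1" using assms by auto
  have "L_ideal n = (mon_ideal n (?W even) \<inter> mon_ideal n (?W odd) :: 'k cut_poly set)"
    unfolding L_ideal_def cut_ideal'_def cut_ideal_eq[OF k(1,2)] exchange_mon_ideal[OF k(3)]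
      swap_even_words[OF k(4)] ..
  also have "\<dots> = mon_ideal n (double_word (n - 1) ` marked_subsets (n - 1))"
  proof -
    have "(\<exists>g\<in>?W even. mon_divides g x) \<and> (\<exists>g\<in>?W odd. mon_divides g x) \<longleftrightarrow>
        (\<exists>g\<in>double_word (n - 1) ` marked_subsets (n - 1). mon_divides g x)" for x
      using both_parities_iff_double_word[of "n - 1" x] by blast
    then show ?thesis unfolding mon_ideal_def by blast
  qed
  finally show ?thesis .
qed

section \<open>Tor from a minimal resolution\<close>

text \<open>
  Elements of a \<open>power_module\<close> are extensional functions on \<open>{..<r}\<close>. This is the isomorphism from
  vectors to them, through which complexes of modules become complexes of matrices.
\<close>

definition coords :: "nat \<Rightarrow> 'b vec \<Rightarrow> nat \<Rightarrow> 'b" where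
  "coords r v = (\<lambda>i\<in>{..<r}. v $ i)"

lemma inj_on_coords: "inj_on (coords r) (carrier_vec r)"
proof (rule inj_onI)
  fix v w :: "'b vec" assume v: "v \<in> carrier_vec r" "w \<in> carrier_vec r" "coords r v = coords r w"
  have "v $ i = w $ i" if "i < r" for i using fun_cong[OF v(3), of i] that by (simp add: coords_def)
  with v show "v = w" by (intro eq_vecI) auto
qed

lemma coords_image: "{..<r} \<rightarrow>\<^sub>E S = coords r ` vecs_in S r"
proof (intro equalityI subsetI)
  fix x assume x: "x \<in> {..<r} \<rightarrow>\<^sub>E S"
  then have "x = coords r (vec r x)" by (auto simp: coords_def fun_eq_iff PiE_def extensional_def)
  moreover have "vec r x \<in> vecs_in S r" using x by (auto simp: vecs_in_def)
  ultimately show "x \<in> coords r ` vecs_in S r" by blast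
qed (auto simp: coords_def vecs_in_def split: if_splits)

text \<open>
  The modules involved carry the addition of an ambient type, and so do their finite sums.
\<close>

lemma finsum_eq_sum:
  fixes N :: "('a, 'b::comm_monoid_add, 'm) module_scheme"
  assumes N: "add N = (+)" "zero N = 0" "0 \<in> carrier N"
    and closed: "\<And>x y. x \<in> carrier N \<Longrightarrow> y \<in> carrier N \<Longrightarrow> x + y \<in> carrier N"
    and f: "\<And>i. i \<in> I \<Longrightarrow> f i \<in> carrier N" and fin: "finite I"
  shows "finsum N f I = sum f I"
proof -
  interpret abelian_monoid N
    by (rule abelian_monoidI) (auto simp: N closed add_ac)
  show ?thesis using fin f
  proof (induction I)
    case (insert i I)
    have "finsum N f (insert i I) = f i \<oplus>\<^bsub>N\<^esub> finsum N f I"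
      using insert by (intro finsum_insert) auto
    with insert show ?case by (simp add: N(1))
  qed (simp add: N(2))
qed

lemma mat_map_coords:
  fixes N :: "('a, 'b::comm_ring_1, 'm) module_scheme"
  assumes N: "add N = (+)" "zero N = 0" "0 \<in> carrier N"
    "\<And>x y. x \<in> carrier N \<Longrightarrow> y \<in> carrier N \<Longrightarrow> x + y \<in> carrier N"
    and sm: "\<And>i k. i < m \<Longrightarrow> k < n \<Longrightarrow> A i k \<odot>\<^bsub>N\<^esub> v $ k = B $$ (i, k) * v $ k \<and> B $$ (i, k) * v $ k \<in> carrier N"
    and B: "B \<in> carrier_mat m n" and v: "v \<in> carrier_vec n"
  shows "mat_map N m n A (coords n v) = coords m (B *\<^sub>v v)"
proof
  fix i show "mat_map N m n A (coords n v) i = coords m (B *\<^sub>v v) i"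
  proof (cases "i < m")
    case True
    have "(\<Oplus>\<^bsub>N\<^esub>k\<in>{..<n}. A i k \<odot>\<^bsub>N\<^esub> coords n v k) = (\<Sum>k<n. A i k \<odot>\<^bsub>N\<^esub> coords n v k)"
      using sm[OF True] by (intro finsum_eq_sum N) (auto simp: coords_def)
    also have "\<dots> = (\<Sum>k<n. B $$ (i, k) * v $ k)"
      using sm[OF True] by (intro sum.cong) (auto simp: coords_def)
    also have "\<dots> = (B *\<^sub>v v) $ i"
      using True B v by (auto simp: scalar_prod_def atLeast0LessThan)
    finally show ?thesis using True by (simp add: mat_map_def coords_def)
  qed (simp add: mat_map_def coords_def)
qed

lemma power_module_simps:
  "carrier (power_module N r) = {..<r} \<rightarrow>\<^sub>E carrier N"
  "zero (power_module N r) = (\<lambda>i\<in>{..<r}. \<zero>\<^bsub>N\<^esub>)"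
  "add (power_module N r) = (\<lambda>x y. \<lambda>i\<in>{..<r}. x i \<oplus>\<^bsub>N\<^esub> y i)"
  "smult (power_module N r) = (\<lambda>a x. \<lambda>i\<in>{..<r}. a \<odot>\<^bsub>N\<^esub> x i)"
  by (simp_all add: power_module_def)

lemma ideal_module_simps:
  "carrier (ideal_module (poly_ring n) J) = J" "zero (ideal_module (poly_ring n) J) = 0"
  "add (ideal_module (poly_ring n) J) = (+)" "smult (ideal_module (poly_ring n) J) = (*)"
  by (simp_all add: ideal_module_def poly_ring_simps)

lemma residue_module_simps:
  "carrier residue_module = UNIV" "zero residue_module = 0" "add residue_module = (+)"
  "smult residue_module = (\<lambda>p c. lookup p 0 * c)"
  by (simp_all add: residue_module_def)

text \<open>
  The differentials of the resolution of \<open>S/J\<close> that belongs to a resolution of \<open>J\<close>: the generators \<open>g\<close>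
  are put in front as a row.
\<close>

definition aug_diff ::
  "(nat \<Rightarrow> nat) \<Rightarrow> (nat \<Rightarrow> nat \<Rightarrow> nat \<Rightarrow> 'a) \<Rightarrow> (nat \<Rightarrow> 'a) \<Rightarrow> nat \<Rightarrow> 'a mat" where
  "aug_diff r d g j = (case j of 0 \<Rightarrow> mat 1 (r 0) (\<lambda>(_, k). g k)
     | Suc i \<Rightarrow> mat (r i) (r (Suc i)) (\<lambda>(a, b). d i a b))"

lemma aug_simps:
  "aug_rank r 0 = 1" "aug_rank r (Suc j) = r j"
  "aug_diff r d g 0 = mat 1 (r 0) (\<lambda>(_, k). g k)"
  "aug_diff r d g (Suc j) = mat (r j) (r (Suc j)) (\<lambda>(a, b). d j a b)"
  by (simp_all add: aug_rank_def aug_diff_def)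

lemma aug_diff_carrier: "aug_diff r d g j \<in> carrier_mat (aug_rank r j) (r j)"
  by (cases j) (simp_all add: aug_simps)

text \<open>Complex and exact at once: every image is the following kernel.\<close>

lemma resolves_iff:
  assumes "subring_set S" "r 0 = 1" "\<And>j. d j \<in> mats_in S (r j) (r (Suc j))"
  shows "resolves S r d J \<longleftrightarrow>
     (\<forall>j. (\<lambda>v. d (Suc j) *\<^sub>v v) ` vecs_in S (r (Suc (Suc j))) =
       {v \<in> vecs_in S (r (Suc j)). d j *\<^sub>v v = 0\<^sub>v (r j)}) \<and>
     J = (\<lambda>v. (d 0 *\<^sub>v v) $ 0) ` vecs_in S (r 1)" (is "?L \<longleftrightarrow> ?R")
proof -
  interpret subring_set S by fact
  note dc = mats_in_carrier[OF assms(3)]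
  show ?thesis
  proof
    assume L: ?L
    have "(\<lambda>v. d (Suc j) *\<^sub>v v) ` vecs_in S (r (Suc (Suc j))) =
       {v \<in> vecs_in S (r (Suc j)). d j *\<^sub>v v = 0\<^sub>v (r j)}" for j
    proof (intro equalityI subsetI)
      fix x assume "x \<in> (\<lambda>v. d (Suc j) *\<^sub>v v) ` vecs_in S (r (Suc (Suc j)))"
      then obtain v where v: "v \<in> vecs_in S (r (Suc (Suc j)))" "x = d (Suc j) *\<^sub>v v" by blast
      have "d j *\<^sub>v x = d j * d (Suc j) *\<^sub>v v"
        using assoc_mult_mat_vec[OF dc dc vecs_in_carrier[OF v(1)]] v(2) by simp
      also have "\<dots> = 0\<^sub>v (r j)"
      proof -
        have dd: "d j * d (Suc j) = 0\<^sub>m (r j) (r (Suc (Suc j)))" using L unfolding resolves_def by blast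
        show ?thesis unfolding dd using vecs_in_carrier[OF v(1)] by (intro eq_vecI) auto
      qed
      finally show "x \<in> {v \<in> vecs_in S (r (Suc j)). d j *\<^sub>v v = 0\<^sub>v (r j)}"
        using mult_vec_in[OF assms(3) v(1)] v(2) by simp
    next
      fix x assume "x \<in> {v \<in> vecs_in S (r (Suc j)). d j *\<^sub>v v = 0\<^sub>v (r j)}"
      then show "x \<in> (\<lambda>v. d (Suc j) *\<^sub>v v) ` vecs_in S (r (Suc (Suc j)))"
        using resolves_exact[OF L, of x j] by blast
    qed
    moreover have "J = (\<lambda>v. (d 0 *\<^sub>v v) $ 0) ` vecs_in S (r 1)"
      using L unfolding resolves_def by blast
    ultimately show ?R by blast
  next
    assume R: ?R
    have "d j * d (Suc j) = 0\<^sub>m (r j) (r (Suc (Suc j)))" for j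
    proof (rule mat_col_eqI)
      fix i assume "i < dim_col (0\<^sub>m (r j) (r (Suc (Suc j))) :: 'a mat)"
      then have i: "i < r (Suc (Suc j))" by simp
      have c: "col (d (Suc j)) i = d (Suc j) *\<^sub>v unit_vec (r (Suc (Suc j))) i"
        by (rule mult_unit_vec[OF dc i, symmetric])
      have "col (d (Suc j)) i \<in> {v \<in> vecs_in S (r (Suc j)). d j *\<^sub>v v = 0\<^sub>v (r j)}"
        unfolding c using R unit_vec_in by blast
      then show "col (d j * d (Suc j)) i = col (0\<^sub>m (r j) (r (Suc (Suc j)))) i"
        using col_mult2[OF dc dc i] i by simp
    qed (use dc[of j] dc[of "Suc j"] in auto)
    moreover have "\<exists>y\<in>vecs_in S (r (Suc (Suc j))). d (Suc j) *\<^sub>v y = x"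
      if "x \<in> vecs_in S (r (Suc j))" "d j *\<^sub>v x = 0\<^sub>v (r j)" for x j
    proof -
      have "x \<in> (\<lambda>v. d (Suc j) *\<^sub>v v) ` vecs_in S (r (Suc (Suc j)))" using R that by blast
      then show ?thesis by blast
    qed
    moreover have "J = {(d 0 *\<^sub>v x) $ 0 | x. x \<in> vecs_in S (r 1)}" using R by blast
    ultimately show ?L using assms(2,3) unfolding resolves_def by blast
  qed
qed

text \<open>
  Through \<open>coords\<close> the boundaries and cycles of the complex of modules are the images and kernels of
  the matrices. The kernel of the augmentation is the kernel of the row \<open>aug_diff r d g 0\<close>, so that all
  degrees are treated alike.
\<close>

lemma free_resolution_iff_resolves:
  fixes J :: "'k::field cut_poly set"
  assumes J: "J \<subseteq> poly_set n" "0 \<in> J" "\<And>p q. p \<in> J \<Longrightarrow> q \<in> J \<Longrightarrow> p + q \<in> J"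
    "\<And>p q. p \<in> J \<Longrightarrow> q \<in> poly_set n \<Longrightarrow> q * p \<in> J"
  shows "free_resolution (poly_ring n) (ideal_module (poly_ring n) J) r d g \<longleftrightarrow>
    resolves (poly_set n) (aug_rank r) (aug_diff r d g) J"
proof -
  let ?S = "poly_set n :: 'k cut_poly set" and ?D = "aug_diff r d g"
  let ?F = "ideal_module (poly_ring n) ?S" and ?V = "\<lambda>r. vecs_in ?S r"
  define aug where "aug x = (\<Oplus>\<^bsub>ideal_module (poly_ring n) J\<^esub>k\<in>{..<r 0}. x k \<odot>\<^bsub>ideal_module (poly_ring n) J\<^esub> g k)" for x
  define E where "E \<longleftrightarrow> (\<forall>k<r 0. g k \<in> J) \<and> (\<forall>j. \<forall>i<r j. \<forall>k<r (Suc j). d j i k \<in> ?S)"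
  have F: "carrier (power_module ?F m) = coords m ` ?V m" for m
    by (simp add: power_module_simps ideal_module_simps coords_image)
  have E_iff: "(\<forall>j. ?D j \<in> mats_in ?S (aug_rank r j) (r j)) \<and> (\<forall>k<r 0. g k \<in> J) \<longleftrightarrow> E"
  proof
    assume l: "(\<forall>j. ?D j \<in> mats_in ?S (aug_rank r j) (r j)) \<and> (\<forall>k<r 0. g k \<in> J)"
    have "?D (Suc j) \<in> mats_in ?S (r j) (r (Suc j))" for j
      using l[THEN conjunct1, rule_format, of "Suc j"] by (simp only: aug_simps(2))
    with l show E by (fastforce simp: E_def mats_in_def aug_simps)
  next
    assume E
    then show "(\<forall>j. ?D j \<in> mats_in ?S (aug_rank r j) (r j)) \<and> (\<forall>k<r 0. g k \<in> J)"
    proof (intro conjI allI)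
      fix j show "?D j \<in> mats_in ?S (aug_rank r j) (r j)"
        using \<open>E\<close> J(1) by (cases j) (auto simp: E_def mats_in_def aug_simps)
    qed (use \<open>E\<close> in \<open>simp add: E_def\<close>)
  qed
  have "free_resolution (poly_ring n) (ideal_module (poly_ring n) J) r d g \<longleftrightarrow> E \<and>
      aug ` carrier (power_module ?F (r 0)) = J \<and>
      boundaries ?F r d 0 = {x \<in> carrier (power_module ?F (r 0)). aug x = 0} \<and>
      (\<forall>j. boundaries ?F r d (Suc j) = cycles ?F r d (Suc j))"
    unfolding free_resolution_def Let_def E_def aug_def
    by (simp add: ideal_module_simps(1,2) poly_ring_simps(1))
  also have "\<dots> \<longleftrightarrow> E \<and> (\<lambda>v. (?D 0 *\<^sub>v v) $ 0) ` ?V (r 0) = J \<and>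
      (\<forall>j. (\<lambda>v. ?D (Suc j) *\<^sub>v v) ` ?V (r (Suc j)) = {v \<in> ?V (r j). ?D j *\<^sub>v v = 0\<^sub>v (aug_rank r j)})"
  proof (rule conj_cong[OF refl])
    assume E
    then have D: "?D j \<in> mats_in ?S (aug_rank r j) (r j)" for j using E_iff by blast
    have D': "?D (Suc j) \<in> mats_in ?S (r j) (r (Suc j))" for j using D[of "Suc j"] by (simp add: aug_simps)
    have aug: "aug (coords (r 0) v) = (?D 0 *\<^sub>v v) $ 0" if v: "v \<in> ?V (r 0)" for v
    proof -
      have "aug (coords (r 0) v) = (\<Sum>k<r 0. coords (r 0) v k * g k)"
        unfolding aug_def ideal_module_simps using v \<open>E\<close>
        by (intro finsum_eq_sum) (auto simp: ideal_module_simps J coords_def vecs_in_def E_def)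
      also have "\<dots> = (?D 0 *\<^sub>v v) $ 0"
        using v by (auto simp: aug_simps scalar_prod_def vecs_in_def coords_def atLeast0LessThan
            mult.commute intro!: sum.cong)
      finally show ?thesis .
    qed
    have mm: "mat_map ?F (r j) (r (Suc j)) (d j) (coords (r (Suc j)) v) = coords (r j) (?D (Suc j) *\<^sub>v v)"
      if v: "v \<in> ?V (r (Suc j))" for v j
    proof (rule mat_map_coords)
      show "d j i k \<odot>\<^bsub>?F\<^esub> v $ k = ?D (Suc j) $$ (i, k) * v $ k \<and> ?D (Suc j) $$ (i, k) * v $ k \<in> carrier ?F"
        if "i < r j" "k < r (Suc j)" for i k
        using that v \<open>E\<close> by (auto simp: ideal_module_simps aug_simps vecs_in_def E_def intro!: poly.mult_closed)
    qed (use v D'[of j] in \<open>auto simp: ideal_module_simps poly.add_closed poly.zero_closed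
          intro: mats_in_carrier vecs_in_carrier\<close>)
    have bd: "boundaries ?F r d j = coords (r j) ` (\<lambda>v. ?D (Suc j) *\<^sub>v v) ` ?V (r (Suc j))" for j
      unfolding boundaries_def F image_image by (intro image_cong refl mm)
    have sub: "(\<lambda>v. ?D (Suc j) *\<^sub>v v) ` ?V (r (Suc j)) \<subseteq> carrier_vec (r j)" for j
      using vecs_in_carrier[OF poly.mult_vec_in[OF D']] by blast
    have ker: "(coords (r j) ` (\<lambda>v. ?D (Suc j) *\<^sub>v v) ` ?V (r (Suc j)) =
        coords (r j) ` {v \<in> ?V (r j). ?D j *\<^sub>v v = 0\<^sub>v (aug_rank r j)}) \<longleftrightarrow>
        (\<lambda>v. ?D (Suc j) *\<^sub>v v) ` ?V (r (Suc j)) = {v \<in> ?V (r j). ?D j *\<^sub>v v = 0\<^sub>v (aug_rank r j)}" for j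
      by (rule inj_on_image_eq_iff[OF inj_on_coords sub]) (auto intro: vecs_in_carrier)
    have z0: "?D 0 *\<^sub>v v = 0\<^sub>v (aug_rank r 0) \<longleftrightarrow> (?D 0 *\<^sub>v v) $ 0 = 0" for v
    proof
      assume "(?D 0 *\<^sub>v v) $ 0 = 0"
      then show "?D 0 *\<^sub>v v = 0\<^sub>v (aug_rank r 0)" by (intro eq_vecI) (auto simp: aug_simps)
    qed (simp add: aug_simps)
    have k0: "{x \<in> carrier (power_module ?F (r 0)). aug x = 0} =
        coords (r 0) ` {v \<in> ?V (r 0). ?D 0 *\<^sub>v v = 0\<^sub>v (aug_rank r 0)}"
      unfolding F z0 using aug by auto
    have zv: "zero (power_module ?F m) = coords m (0\<^sub>v m)" for m
      by (auto simp: power_module_simps ideal_module_simps coords_def fun_eq_iff)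
    have cy: "cycles ?F r d (Suc j) =
        coords (r (Suc j)) ` {v \<in> ?V (r (Suc j)). ?D (Suc j) *\<^sub>v v = 0\<^sub>v (aug_rank r (Suc j))}" for j
    proof -
      have "mat_map ?F (r j) (r (Suc j)) (d j) (coords (r (Suc j)) v) = zero (power_module ?F (r j))
          \<longleftrightarrow> ?D (Suc j) *\<^sub>v v = 0\<^sub>v (aug_rank r (Suc j))" if v: "v \<in> ?V (r (Suc j))" for v
        unfolding mm[OF v] zv aug_simps(2)
        by (rule inj_on_eq_iff[OF inj_on_coords]) (use sub v in auto)
      then show ?thesis unfolding cycles_def by (auto simp: F)
    qed
    have "aug ` carrier (power_module ?F (r 0)) = (\<lambda>v. (?D 0 *\<^sub>v v) $ 0) ` ?V (r 0)"
      unfolding F image_image by (intro image_cong refl aug)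
    moreover have "(boundaries ?F r d 0 = {x \<in> carrier (power_module ?F (r 0)). aug x = 0} \<and>
      (\<forall>j. boundaries ?F r d (Suc j) = cycles ?F r d (Suc j))) \<longleftrightarrow>
      (\<forall>j. (\<lambda>v. ?D (Suc j) *\<^sub>v v) ` ?V (r (Suc j)) = {v \<in> ?V (r j). ?D j *\<^sub>v v = 0\<^sub>v (aug_rank r j)})"
    proof -
      define Q where "Q j \<longleftrightarrow> (\<lambda>v. ?D (Suc j) *\<^sub>v v) ` ?V (r (Suc j)) =
        {v \<in> ?V (r j). ?D j *\<^sub>v v = 0\<^sub>v (aug_rank r j)}" for j
      have "Q 0 \<and> (\<forall>j. Q (Suc j)) \<longleftrightarrow> (\<forall>j. Q j)" by (metis not0_implies_Suc)
      then show ?thesis unfolding bd k0 cy ker Q_def .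
    qed
    ultimately show "(aug ` carrier (power_module ?F (r 0)) = J \<and>
      boundaries ?F r d 0 = {x \<in> carrier (power_module ?F (r 0)). aug x = 0} \<and>
      (\<forall>j. boundaries ?F r d (Suc j) = cycles ?F r d (Suc j))) \<longleftrightarrow>
      ((\<lambda>v. (?D 0 *\<^sub>v v) $ 0) ` ?V (r 0) = J \<and>
      (\<forall>j. (\<lambda>v. ?D (Suc j) *\<^sub>v v) ` ?V (r (Suc j)) = {v \<in> ?V (r j). ?D j *\<^sub>v v = 0\<^sub>v (aug_rank r j)}))"
      by simp
  qed
  also have "\<dots> \<longleftrightarrow> resolves ?S (aug_rank r) ?D J"
  proof -
    have m: "resolves ?S (aug_rank r) ?D J \<Longrightarrow> E"
    proof -
      assume res: "resolves ?S (aug_rank r) ?D J"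
      have D: "?D j \<in> mats_in ?S (aug_rank r j) (r j)" for j
        using poly.resolves_d[OF res, of j] by (simp add: aug_simps)
      have "g k \<in> J" if k: "k < r 0" for k
      proof -
        have "?D 0 $$ (0, k) \<in> J"
          using poly.resolves_generator[OF res, of k] k by (simp add: aug_rank_def)
        then show ?thesis using k by (simp add: aug_simps)
      qed
      with D E_iff show E by blast
    qed
    have "resolves ?S (aug_rank r) ?D J \<longleftrightarrow>
        (\<forall>j. (\<lambda>v. ?D (Suc j) *\<^sub>v v) ` ?V (r (Suc j)) = {v \<in> ?V (r j). ?D j *\<^sub>v v = 0\<^sub>v (aug_rank r j)}) \<and>
        J = (\<lambda>v. (?D 0 *\<^sub>v v) $ 0) ` ?V (r 0)" if E
    proof -
      have "?D j \<in> mats_in ?S (aug_rank r j) (aug_rank r (Suc j))" for j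
        using that E_iff by (simp add: aug_simps)
      from resolves_iff[OF subring_set_poly aug_simps(1) this, of J] show ?thesis
        by (simp only: aug_simps One_nat_def)
    qed
    with m show ?thesis by blast
  qed
  finally show ?thesis .
qed

text \<open>
  Only \<open>V\<close> has to be known as a vector space: a bijection that respects all operations carries its
  axioms over to \<open>N\<close>. This spares the verification of the axioms for cosets.
\<close>

lemma dim_transport:
  fixes V :: "('k::field, 'v) module" and N :: "('k, 'w) module"
  assumes V: "vectorspace class_ring V" and fin_V: "vectorspace.fin_dim class_ring V"
    and bij: "bij_betw h (carrier V) (carrier N)"
    and add: "\<And>x y. x \<in> carrier V \<Longrightarrow> y \<in> carrier V \<Longrightarrow> h (x \<oplus>\<^bsub>V\<^esub> y) = h x \<oplus>\<^bsub>N\<^esub> h y"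
    and smult: "\<And>c x. x \<in> carrier V \<Longrightarrow> h (c \<odot>\<^bsub>V\<^esub> x) = c \<odot>\<^bsub>N\<^esub> h x"
    and zero: "h \<zero>\<^bsub>V\<^esub> = \<zero>\<^bsub>N\<^esub>"
  shows "vectorspace.dim class_ring N = vectorspace.dim class_ring V"
proof -
  interpret V: vectorspace class_ring V by fact
  have im: "carrier N = h ` carrier V" using bij by (simp add: bij_betw_def)
  have add': "h x \<oplus>\<^bsub>N\<^esub> h y = h (x \<oplus>\<^bsub>V\<^esub> y)" if "x \<in> carrier V" "y \<in> carrier V" for x y
    using add that by simp
  have smult': "c \<odot>\<^bsub>N\<^esub> h x = h (c \<odot>\<^bsub>V\<^esub> x)" if "x \<in> carrier V" for c x
    using smult that by simp
  have sc: "c \<odot>\<^bsub>V\<^esub> x \<in> carrier V" if "x \<in> carrier V" for c x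
    using V.smult_closed[of c x] that by simp
  have AG: "abelian_group N"
  proof (rule abelian_groupI)
    show "\<exists>y\<in>carrier N. y \<oplus>\<^bsub>N\<^esub> x = \<zero>\<^bsub>N\<^esub>" if x: "x \<in> carrier N" for x
    proof -
      obtain v where v: "v \<in> carrier V" "x = h v" using x im by blast
      have "h (\<ominus>\<^bsub>V\<^esub> v) \<oplus>\<^bsub>N\<^esub> x = \<zero>\<^bsub>N\<^esub>"
        using v add'[of "\<ominus>\<^bsub>V\<^esub> v" v] by (simp add: zero[symmetric] V.l_neg)
      then show ?thesis using v im by blast
    qed
  qed (auto simp: im add' zero[symmetric] V.a_ac)
  have mod: "module class_ring N"
  proof (rule moduleI[OF _ AG])
    show "cring (class_ring :: 'k ring)" by (rule fieldE(1)[OF class_field])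
  qed (use V.smult_l_distr V.smult_r_distr V.smult_assoc1 V.smult_one in
      \<open>auto simp: im add' smult' sc\<close>)
  have N: "vectorspace class_ring N"
    using mod class_field by (simp add: vectorspace_def)
  have "linear_map class_ring V N h"
    unfolding linear_map_def mod_hom_def mod_hom_axioms_def LinearCombinations.module_hom_def
    using V N mod V.module_axioms add smult im by auto
  then interpret linear_map class_ring V N h .
  show ?thesis
    using dim_eq[OF fin_V] bij by (simp add: bij_betw_def)
qed

lemma lookup_pconst: "lookup (pconst c) 0 = c"
  by (simp add: pconst_def)

text \<open>
  If the columns of \<open>P\<close> form a basis of a complement of \<open>B\<close> in \<open>Z\<close>, then \<open>x \<mapsto> P x + B\<close> is an isomorphism
  onto \<open>Z/B\<close>. Here \<open>Z/B\<close> is the concrete quotient of subsets of a power of the residue field, with the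
  scalars acting through constant polynomials.
\<close>

lemma dim_quotient_of_residue_power:
  fixes B Z :: "'k::field vec set" and P :: "'k mat"
  assumes Z: "Z \<subseteq> carrier_vec r" and B: "B \<subseteq> carrier_vec r" "0\<^sub>v r \<in> B"
    "\<And>u v. u \<in> B \<Longrightarrow> v \<in> B \<Longrightarrow> u + v \<in> B" "\<And>c u. u \<in> B \<Longrightarrow> c \<cdot>\<^sub>v u \<in> B"
    and P: "P \<in> carrier_mat r b" "\<And>x. x \<in> carrier_vec b \<Longrightarrow> P *\<^sub>v x \<in> Z"
    and span: "\<And>z. z \<in> Z \<Longrightarrow> \<exists>x\<in>carrier_vec b. P *\<^sub>v x - z \<in> B"
    and indep: "\<And>x. x \<in> carrier_vec b \<Longrightarrow> P *\<^sub>v x \<in> B \<Longrightarrow> x = 0\<^sub>v b"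
  shows "vectorspace.dim class_ring (restrict_scalars pconst
    (quotient_module ((power_module residue_module r)\<lparr>carrier := coords r ` Z\<rparr>) (coords r ` B))) = b"
proof -
  let ?M = "(power_module residue_module r)\<lparr>carrier := coords r ` Z\<rparr> :: ('k cut_poly, nat \<Rightarrow> 'k) module"
  let ?N = "restrict_scalars pconst (quotient_module ?M (coords r ` B))"
  \<comment> \<open>\<open>K z\<close> is the coset of \<open>z\<close>.\<close>
  define K where "K z = coords r ` (\<lambda>u. u + z) ` B" for z
  have addM: "add ?M (coords r v) (coords r w) = coords r (v + w)"
    if "v \<in> carrier_vec r" "w \<in> carrier_vec r" for v w
    using that by (auto simp: power_module_simps residue_module_simps coords_def fun_eq_iff)
  have smM: "pconst c \<odot>\<^bsub>?M\<^esub> coords r v = coords r (c \<cdot>\<^sub>v v)" if "v \<in> carrier_vec r" for c v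
    using that by (auto simp: power_module_simps residue_module_simps coords_def fun_eq_iff lookup_pconst)
  have coset: "coords r ` B +>\<^bsub>?M\<^esub> coords r z = K z" if z: "z \<in> carrier_vec r" for z
  proof -
    have "coords r ` B +>\<^bsub>?M\<^esub> coords r z = (\<lambda>u. add ?M (coords r u) (coords r z)) ` B"
      unfolding a_r_coset_def r_coset_def by auto
    also have "\<dots> = K z"
      unfolding K_def image_image using B z by (intro image_cong refl addM) auto
    finally show ?thesis .
  qed
  have carrN: "carrier ?N = K ` Z"
  proof -
    have "carrier ?N = (\<lambda>z. coords r ` B +>\<^bsub>?M\<^esub> coords r z) ` Z"
      unfolding restrict_scalars_def quotient_module_def A_RCOSETS_def RCOSETS_def a_r_coset_def by auto
    also have "\<dots> = K ` Z" using Z by (intro image_cong refl coset) auto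
    finally show ?thesis .
  qed
  have K_eq: "K z = K w \<longleftrightarrow> z - w \<in> B" if z: "z \<in> carrier_vec r" and w: "w \<in> carrier_vec r" for z w
  proof
    assume e: "K z = K w"
    have "coords r (0\<^sub>v r + z) \<in> K z" unfolding K_def using B by blast
    then obtain u where u: "u \<in> B" "coords r (0\<^sub>v r + z) = coords r (u + w)"
      unfolding e by (auto simp: K_def)
    have uc: "u \<in> carrier_vec r" using u B by blast
    have "0\<^sub>v r + z = u + w"
      by (rule inj_onD[OF inj_on_coords u(2)]) (use z w uc in auto)
    then have "z - w = u" using z w uc by auto
    then show "z - w \<in> B" using u by simp
  next
    assume d: "z - w \<in> B"
    have "- (z - w) = (-1) \<cdot>\<^sub>v (z - w)" using z w by (intro eq_vecI) auto
    then have d': "- (z - w) \<in> B" using B(4)[OF d] by simp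
    have "K z \<subseteq> K w"
    proof
      fix y assume "y \<in> K z"
      then obtain u where u: "u \<in> B" "y = coords r (u + z)" by (auto simp: K_def)
      have "u + z = (u + (z - w)) + w" using u B z w by (intro eq_vecI) (auto simp: subset_iff)
      then show "y \<in> K w" using B(3)[OF u(1) d] u(2) by (auto simp: K_def)
    qed
    moreover have "K w \<subseteq> K z"
    proof
      fix y assume "y \<in> K w"
      then obtain u where u: "u \<in> B" "y = coords r (u + w)" by (auto simp: K_def)
      have "u + w = (u + - (z - w)) + z" using u B z w by (intro eq_vecI) (auto simp: subset_iff)
      then show "y \<in> K z" using B(3)[OF u(1) d'] u(2) by (auto simp: K_def)
    qed
    ultimately show "K z = K w" by blast
  qed
  have Kadd: "K z \<oplus>\<^bsub>?N\<^esub> K w = K (z + w)" if z: "z \<in> carrier_vec r" and w: "w \<in> carrier_vec r" for z w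
  proof -
    have "K z \<oplus>\<^bsub>?N\<^esub> K w = (\<Union>x\<in>K z. \<Union>y\<in>K w. {add ?M x y})"
      unfolding restrict_scalars_def quotient_module_def set_add_def set_mult_def by simp
    also have "\<dots> = (\<Union>u\<in>B. \<Union>v\<in>B. {add ?M (coords r (u + z)) (coords r (v + w))})"
      by (simp add: K_def)
    also have "\<dots> = (\<Union>u\<in>B. \<Union>v\<in>B. {coords r ((u + z) + (v + w))})"
    proof (intro SUP_cong refl)
      fix u v assume "u \<in> B" "v \<in> B"
      then show "{add ?M (coords r (u + z)) (coords r (v + w))} = {coords r ((u + z) + (v + w))}"
        using addM[of "u + z" "v + w"] B(1) z w by (auto simp only: add_carrier_vec subset_iff)
    qed
    also have "\<dots> = K (z + w)"
    proof (intro equalityI subsetI)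
      fix y assume "y \<in> (\<Union>u\<in>B. \<Union>v\<in>B. {coords r ((u + z) + (v + w))})"
      then obtain u v where uv: "u \<in> B" "v \<in> B" "y = coords r ((u + z) + (v + w))" by blast
      have "(u + z) + (v + w) = (u + v) + (z + w)"
        using uv B z w by (intro eq_vecI) (auto simp: subset_iff)
      then show "y \<in> K (z + w)" using uv B(3) by (auto simp: K_def)
    next
      fix y assume "y \<in> K (z + w)"
      then obtain u where u: "u \<in> B" "y = coords r (u + (z + w))" by (auto simp: K_def)
      have "u + (z + w) = (u + z) + (0\<^sub>v r + w)"
        using u B z w by (intro eq_vecI) (auto simp: subset_iff)
      then show "y \<in> (\<Union>u\<in>B. \<Union>v\<in>B. {coords r ((u + z) + (v + w))})" using u B(2) by auto
    qed
    finally show ?thesis .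
  qed
  have Ksm: "c \<odot>\<^bsub>?N\<^esub> K z = K (c \<cdot>\<^sub>v z)" if z: "z \<in> carrier_vec r" for c z
  proof -
    have "c \<odot>\<^bsub>?N\<^esub> K z = (\<Union>x\<in>K z. coords r ` B +>\<^bsub>?M\<^esub> (pconst c \<odot>\<^bsub>?M\<^esub> x))"
      unfolding restrict_scalars_def quotient_module_def by simp
    also have "\<dots> = (\<Union>u\<in>B. coords r ` B +>\<^bsub>?M\<^esub> (pconst c \<odot>\<^bsub>?M\<^esub> coords r (u + z)))"
      by (simp add: K_def)
    also have "\<dots> = (\<Union>u\<in>B. K (c \<cdot>\<^sub>v z))"
    proof (intro SUP_cong refl)
      fix u assume u: "u \<in> B"
      then have uc: "u \<in> carrier_vec r" using B by blast
      have "c \<cdot>\<^sub>v (u + z) - c \<cdot>\<^sub>v z = c \<cdot>\<^sub>v u"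
        using uc z by (intro eq_vecI) (auto simp: algebra_simps)
      then have "K (c \<cdot>\<^sub>v (u + z)) = K (c \<cdot>\<^sub>v z)" using K_eq[of "c \<cdot>\<^sub>v (u + z)" "c \<cdot>\<^sub>v z"] B(4)[OF u] uc z by simp
      then show "coords r ` B +>\<^bsub>?M\<^esub> (pconst c \<odot>\<^bsub>?M\<^esub> coords r (u + z)) = K (c \<cdot>\<^sub>v z)"
        using uc z by (simp only: smM[of "u + z"] coset add_carrier_vec smult_carrier_vec)
    qed
    also have "\<dots> = K (c \<cdot>\<^sub>v z)" using B(2) by blast
    finally show ?thesis .
  qed
  have Kz: "K (0\<^sub>v r) = \<zero>\<^bsub>?N\<^esub>"
  proof -
    have "(\<lambda>u. u + 0\<^sub>v r) ` B = B" using B(1) by (auto simp: subset_iff image_iff)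
    then show ?thesis by (simp add: K_def restrict_scalars_def quotient_module_def)
  qed
  have bij: "bij_betw (\<lambda>x. K (P *\<^sub>v x)) (carrier_vec b) (carrier ?N)"
    unfolding bij_betw_def
  proof
    show "inj_on (\<lambda>x. K (P *\<^sub>v x)) (carrier_vec b)"
    proof (rule inj_onI)
      fix x y assume xy: "x \<in> carrier_vec b" "y \<in> carrier_vec b" "K (P *\<^sub>v x) = K (P *\<^sub>v y)"
      then have "P *\<^sub>v x - P *\<^sub>v y \<in> B" using K_eq[of "P *\<^sub>v x" "P *\<^sub>v y"] P(1) by auto
      then have "P *\<^sub>v (x - y) \<in> B" using mult_minus_distrib_mat_vec[OF P(1) xy(1,2)] by simp
      then have d: "x - y = 0\<^sub>v b" using indep xy by simp
      have "x = (x - y) + y" using xy by (intro eq_vecI) auto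
      then show "x = y" unfolding d using xy by simp
    qed
    show "(\<lambda>x. K (P *\<^sub>v x)) ` carrier_vec b = carrier ?N"
      unfolding carrN
    proof (intro equalityI subsetI)
      fix y assume "y \<in> K ` Z"
      then obtain z where z: "z \<in> Z" "y = K z" by blast
      obtain x where x: "x \<in> carrier_vec b" "P *\<^sub>v x - z \<in> B" using span z by blast
      have "K (P *\<^sub>v x) = K z" using K_eq[of "P *\<^sub>v x" z] P(1) x z Z by auto
      then show "y \<in> (\<lambda>x. K (P *\<^sub>v x)) ` carrier_vec b" using x z by blast
    qed (use P(2) in blast)
  qed
  have "vectorspace.dim class_ring ?N = vectorspace.dim class_ring (module_vec TYPE('k) b)"
  proof (rule dim_transport[OF vec_vs, where h = "\<lambda>x. K (P *\<^sub>v x)"])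
    show "vectorspace.fin_dim class_ring (module_vec TYPE('k) b)" by (rule vec_space.fin_dim)
    show "bij_betw (\<lambda>x. K (P *\<^sub>v x)) (carrier (module_vec TYPE('k) b)) (carrier ?N)"
      using bij by (simp add: module_vec_simps)
    show "K (P *\<^sub>v (x \<oplus>\<^bsub>module_vec TYPE('k) b\<^esub> y)) = K (P *\<^sub>v x) \<oplus>\<^bsub>?N\<^esub> K (P *\<^sub>v y)"
      if "x \<in> carrier (module_vec TYPE('k) b)" "y \<in> carrier (module_vec TYPE('k) b)" for x y
      using that P(1) mult_add_distrib_mat_vec[OF P(1), of x y] Kadd[of "P *\<^sub>v x" "P *\<^sub>v y"]
      by (simp add: module_vec_simps)
    show "K (P *\<^sub>v (c \<odot>\<^bsub>module_vec TYPE('k) b\<^esub> x)) = c \<odot>\<^bsub>?N\<^esub> K (P *\<^sub>v x)"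
      if "x \<in> carrier (module_vec TYPE('k) b)" for c x
      using that P(1) mult_mat_vec[OF P(1), of x c] Ksm[of "P *\<^sub>v x" c]
      by (simp add: module_vec_simps)
    have "P *\<^sub>v 0\<^sub>v b = 0\<^sub>v r" using P(1) by auto
    then show "K (P *\<^sub>v \<zero>\<^bsub>module_vec TYPE('k) b\<^esub>) = \<zero>\<^bsub>?N\<^esub>"
      using Kz by (simp add: module_vec_simps)
  qed
  also have "\<dots> = b" by (rule vec_space.dim_is_n)
  finally show ?thesis .
qed

text \<open>A sum of two exponents is \<open>0\<close> only if both are, so no other terms contribute.\<close>

lemma constant_coeff_mult:
  "lookup (p * q) 0 = lookup p 0 * lookup q 0" for p q :: "'k::field cut_poly"
proof -
  let ?r = "filter_keys (\<lambda>m. m \<noteq> 0) p"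
  have p: "p = single 0 (lookup p 0) + ?r"
    by (rule poly_mapping_eqI) (simp add: lookup_add lookup_filter_keys lookup_single when_def)
  have "0 \<notin> keys (?r * q)"
  proof
    assume "0 \<in> keys (?r * q)"
    then obtain a c where ac: "a \<in> keys ?r" "(0 :: cut_var \<Rightarrow>\<^sub>0 nat) = a + c"
      by (rule keys_mult_elim)
    have "lookup a v = 0" for v using arg_cong[OF ac(2), of "\<lambda>m. lookup m v"] by (simp add: lookup_add)
    then have "a = 0" by (intro poly_mapping_eqI) simp
    then show False using ac(1) by (simp add: keys_filter_keys)
  qed
  then have "lookup (p * q) 0 = lookup (single 0 (lookup p 0) * q) 0"
    by (subst p) (simp add: distrib_right lookup_add in_keys_iff)
  also have "\<dots> = lookup p 0 * lookup q 0"
    unfolding lookup_mult by (simp add: lookup_single when_mult)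
  finally show ?thesis .
qed

lemma constant_coeff_hom: "comm_ring_hom (\<lambda>p :: 'k::field cut_poly. lookup p 0)"
  by unfold_locales (simp_all add: lookup_add constant_coeff_mult)

lemma constant_coeff_homogeneous:
  "homogeneous n k p \<Longrightarrow> k > 0 \<Longrightarrow> lookup p 0 = 0"
  by (rule ccontr) (force simp: homogeneous_def mon_degree_def simp flip: lookup_not_eq_zero_eq_in_keys)

text \<open>
  The resolution chosen by \<open>Tor\<close> is compared with \<open>G\<close>: the map \<open>\<Psi>\<close> of \<open>minimal_comparison\<close> gives a basis of
  its homology. In degree \<open>0\<close> all vectors are cycles; this agrees with the kernel of the augmentation
  row because the elements of \<open>J\<close> have no constant term.
\<close>

lemma betti_of_minimal_resolution:
  fixes J :: "'k::field cut_poly set"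
  assumes J: "J \<subseteq> poly_set n" "0 \<in> J" "\<And>p q. p \<in> J \<Longrightarrow> q \<in> J \<Longrightarrow> p + q \<in> J"
    "\<And>p q. p \<in> J \<Longrightarrow> q \<in> poly_set n \<Longrightarrow> q * p \<in> J"
    and J0: "\<And>p. p \<in> J \<Longrightarrow> lookup p 0 = 0"
    and G: "resolves (poly_set n) (aug_rank b) G J"
    and min: "\<And>j. map_mat (\<lambda>p. lookup p 0) (G j) = 0\<^sub>m (aug_rank b j) (aug_rank b (Suc j))"
  shows "betti n (ideal_module (poly_ring n) J) j = b j"
proof -
  let ?R = "poly_ring n :: 'k cut_poly ring" and ?M = "ideal_module (poly_ring n) J"
  let ?\<epsilon> = "\<lambda>p :: 'k cut_poly. lookup p 0"
  have "aug_diff b (\<lambda>j i k. G (Suc j) $$ (i, k)) (\<lambda>k. G 0 $$ (0, k)) = G"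
  proof
    fix i
    show "aug_diff b (\<lambda>j i k. G (Suc j) $$ (i, k)) (\<lambda>k. G 0 $$ (0, k)) i = G i"
      using mats_in_carrier[OF poly.resolves_d[OF G, of i]]
      by (cases i) (auto simp: aug_simps intro!: eq_matI)
  qed
  then have "free_resolution ?R ?M b (\<lambda>j i k. G (Suc j) $$ (i, k)) (\<lambda>k. G 0 $$ (0, k))"
    using free_resolution_iff_resolves[OF J] G by simp
  then have ex: "\<exists>x. case x of (r, d) \<Rightarrow> \<exists>g. free_resolution ?R ?M r d g" by auto
  obtain r d where rd: "(SOME (r, d). \<exists>g. free_resolution ?R ?M r d g) = (r, d)" by force
  then obtain g where "free_resolution ?R ?M r d g" using someI_ex[OF ex] by auto
  then have F: "resolves (poly_set n) (aug_rank r) (aug_diff r d g) J"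
    using free_resolution_iff_resolves[OF J] by blast
  define D where "D j = map_mat ?\<epsilon> (aug_diff r d g j)" for j
  have Dc: "D j \<in> carrier_mat (aug_rank r j) (r j)" for j
    using aug_diff_carrier[of r d g j] by (simp add: D_def)
  obtain \<Phi> \<Psi> H where c: "\<Phi> \<in> carrier_mat (b j) (r j)" "\<Psi> \<in> carrier_mat (r j) (b j)"
      "H \<in> carrier_mat (r (Suc j)) (r j)"
    and \<Phi>\<Psi>: "\<Phi> * \<Psi> = 1\<^sub>m (b j)" and D\<Psi>: "D j * \<Psi> = 0\<^sub>m (aug_rank r j) (b j)"
    and \<Phi>D: "\<Phi> * D (Suc j) = 0\<^sub>m (b j) (r (Suc j))"
    and hom: "\<And>z. z \<in> carrier_vec (r j) \<Longrightarrow> D j *\<^sub>v z = 0\<^sub>v (aug_rank r j) \<Longrightarrow>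
        \<Psi> *\<^sub>v (\<Phi> *\<^sub>v z) = z + D (Suc j) *\<^sub>v (H *\<^sub>v z)"
    using minimal_comparison[OF subring_set_poly constant_coeff_hom F G min, of j]
    unfolding aug_simps(2) D_def[symmetric] by blast
  have Dc': "D (Suc j) \<in> carrier_mat (r j) (r (Suc j))" for j using Dc[of "Suc j"] by (simp add: aug_simps)
  have add_diff: "v + w - v = w" if "v \<in> carrier_vec m" "w \<in> carrier_vec m" for v w :: "'k vec" and m
    using that by (intro eq_vecI) auto
  define Z where "Z = {v \<in> carrier_vec (r j). D j *\<^sub>v v = 0\<^sub>v (aug_rank r j)}"
  define B where "B = (\<lambda>v. D (Suc j) *\<^sub>v v) ` carrier_vec (r (Suc j))"
  have U: "{..<m} \<rightarrow>\<^sub>E carrier (residue_module :: ('k cut_poly, 'k) module) = coords m ` carrier_vec m" for m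
    by (simp add: residue_module_simps coords_image vecs_in_def)
  have mm: "mat_map residue_module (r i) (r (Suc i)) (d i) (coords (r (Suc i)) v) = coords (r i) (D (Suc i) *\<^sub>v v)"
    if v: "v \<in> carrier_vec (r (Suc i))" for v i
    by (rule mat_map_coords[OF _ _ _ _ _ Dc' v]) (auto simp: residue_module_simps D_def aug_simps)
  have cyc: "cycles residue_module r d j = coords (r j) ` Z"
  proof (cases j)
    case 0
    have "D 0 *\<^sub>v v = 0\<^sub>v 1" if v: "v \<in> carrier_vec (r 0)" for v
    proof -
      have "g k \<in> J" if k: "k < r 0" for k
      proof -
        have "aug_diff r d g 0 $$ (0, k) \<in> J"
          using poly.resolves_generator[OF F, of k] k by (simp add: aug_rank_def)
        then show ?thesis using k by (simp add: aug_simps)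
      qed
      then show ?thesis
        using J0 v by (intro eq_vecI) (auto simp: D_def aug_simps scalar_prod_def)
    qed
    then have "Z = carrier_vec (r 0)" using 0 by (auto simp: Z_def aug_simps)
    then show ?thesis using 0 U by (simp add: cycles_def power_module_simps)
  next
    case (Suc i)
    have zv: "zero (power_module (residue_module :: ('k cut_poly, 'k) module) m) = coords m (0\<^sub>v m)" for m
      by (auto simp: power_module_simps residue_module_simps coords_def fun_eq_iff)
    have "mat_map residue_module (r i) (r (Suc i)) (d i) (coords (r (Suc i)) v)
        = zero (power_module residue_module (r i)) \<longleftrightarrow> D (Suc i) *\<^sub>v v = 0\<^sub>v (aug_rank r (Suc i))"
      if v: "v \<in> carrier_vec (r (Suc i))" for v
      unfolding mm[OF v] zv aug_simps(2)
      by (rule inj_on_eq_iff[OF inj_on_coords]) (use Dc'[of i] v in auto)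
    then show ?thesis
      unfolding cycles_def Suc Z_def by (auto simp: power_module_simps(1) U)
  qed
  have bd: "boundaries residue_module r d j = coords (r j) ` B"
    unfolding boundaries_def B_def power_module_simps(1) U image_image
    by (intro image_cong refl mm)
  have "vectorspace.dim class_ring (restrict_scalars pconst (homology residue_module r d j)) = b j"
    unfolding homology_def cyc bd
  proof (rule dim_quotient_of_residue_power[OF _ _ _ _ _ c(2)])
    show "Z \<subseteq> carrier_vec (r j)" by (auto simp: Z_def)
    show "B \<subseteq> carrier_vec (r j)" using Dc'[of j] by (auto simp: B_def)
    have "D (Suc j) *\<^sub>v 0\<^sub>v (r (Suc j)) = 0\<^sub>v (r j)" using Dc'[of j] by auto
    then show "0\<^sub>v (r j) \<in> B" unfolding B_def by (metis image_eqI zero_carrier_vec)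
    show "u + v \<in> B" if uv: "u \<in> B" "v \<in> B" for u v
    proof -
      obtain x y where "x \<in> carrier_vec (r (Suc j))" "y \<in> carrier_vec (r (Suc j))"
          "u = D (Suc j) *\<^sub>v x" "v = D (Suc j) *\<^sub>v y" using uv by (auto simp: B_def)
      then show ?thesis
        unfolding B_def using mult_add_distrib_mat_vec[OF Dc', of x j y]
        by (intro image_eqI[of _ _ "x + y"]) auto
    qed
    show "a \<cdot>\<^sub>v u \<in> B" if u: "u \<in> B" for a u
    proof -
      obtain x where "x \<in> carrier_vec (r (Suc j))" "u = D (Suc j) *\<^sub>v x" using u by (auto simp: B_def)
      then show ?thesis
        unfolding B_def using mult_mat_vec[OF Dc', of x j a]
        by (intro image_eqI[of _ _ "a \<cdot>\<^sub>v x"]) auto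
    qed
    show "\<Psi> *\<^sub>v x \<in> Z" if x: "x \<in> carrier_vec (b j)" for x
    proof -
      have "D j *\<^sub>v (\<Psi> *\<^sub>v x) = 0\<^sub>m (aug_rank r j) (b j) *\<^sub>v x"
        using assoc_mult_mat_vec[OF Dc c(2) x] D\<Psi> by simp
      also have "\<dots> = 0\<^sub>v (aug_rank r j)" using x by (intro eq_vecI) auto
      finally show ?thesis using c(2) x by (simp add: Z_def)
    qed
    show "\<exists>x\<in>carrier_vec (b j). \<Psi> *\<^sub>v x - z \<in> B" if z: "z \<in> Z" for z
    proof (rule bexI)
      have zc: "z \<in> carrier_vec (r j)" using z by (simp add: Z_def)
      show "\<Phi> *\<^sub>v z \<in> carrier_vec (b j)" using c(1) zc by simp
      have Hz: "H *\<^sub>v z \<in> carrier_vec (r (Suc j))" using c(3) zc by simp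
      have "\<Psi> *\<^sub>v (\<Phi> *\<^sub>v z) - z = D (Suc j) *\<^sub>v (H *\<^sub>v z)"
        unfolding hom[OF zc z[unfolded Z_def, simplified, THEN conjunct2]]
        by (rule add_diff[OF zc mult_mat_vec_carrier[OF Dc' Hz]])
      then show "\<Psi> *\<^sub>v (\<Phi> *\<^sub>v z) - z \<in> B" using Hz by (simp add: B_def)
    qed
    show "x = 0\<^sub>v (b j)" if x: "x \<in> carrier_vec (b j)" "\<Psi> *\<^sub>v x \<in> B" for x
    proof -
      obtain y where y: "y \<in> carrier_vec (r (Suc j))" "\<Psi> *\<^sub>v x = D (Suc j) *\<^sub>v y"
        using x(2) by (auto simp: B_def)
      have "x = \<Phi> *\<^sub>v (\<Psi> *\<^sub>v x)" using assoc_mult_mat_vec[OF c(1,2) x(1)] \<Phi>\<Psi> x(1) by simp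
      also have "\<dots> = 0\<^sub>m (b j) (r (Suc j)) *\<^sub>v y"
        unfolding y(2) using assoc_mult_mat_vec[OF c(1) Dc' y(1)] \<Phi>D by simp
      also have "\<dots> = 0\<^sub>v (b j)" using y(1) by (intro eq_vecI) auto
      finally show ?thesis .
    qed
  qed
  then show ?thesis unfolding betti_def Tor_def rd by simp
qed

text \<open>A subset and its complement together have \<open>m\<close> elements.\<close>

lemma sum_card_subsets: "(\<Sum>I\<in>Pow {1..m}. card I) = m * 2 ^ (m - 1)"
proof -
  have "(\<Sum>I\<in>Pow {1..m}. card I) = (\<Sum>I\<in>Pow {1..m}. card ({1..m} - I))"
    by (rule sum.reindex_bij_witness[of _ "\<lambda>I. {1..m} - I" "\<lambda>I. {1..m} - I"])
      (auto simp: double_diff)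
  then have "2 * (\<Sum>I\<in>Pow {1..m}. card I) = (\<Sum>I\<in>Pow {1..m}. card I + card ({1..m} - I))"
    by (simp add: sum.distrib)
  also have "\<dots> = (\<Sum>I\<in>Pow {1..m}. m)"
  proof (rule sum.cong[OF refl])
    fix I assume "I \<in> Pow {1..m}"
    then have "I \<subseteq> {1..m}" "finite I" using finite_subset by auto
    then show "card I + card ({1..m} - I) = m"
      using card_mono[of "{1..m}" I] by (simp add: card_Diff_subset)
  qed
  also have "\<dots> = m * 2 ^ m" by (simp add: card_Pow)
  finally show ?thesis by (cases m) auto
qed

theorem corollary5p6:
  fixes n :: nat
  assumes "n \<ge> 4"
  shows "(\<forall>j. betti n (ideal_module (poly_ring n) (L_ideal n :: 'k::field cut_poly set)) j =
            (\<Sum>I\<in>{I. I \<noteq> {} \<and> I \<subseteq> {1..n - 1}}. \<Sum>i\<in>I. r_num n I i choose j)) \<and>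
         betti n (ideal_module (poly_ring n) (L_ideal n :: 'k cut_poly set)) 0 = (n - 1) * 2 ^ (n - 2)"
proof -
  let ?G = "double_word (n - 1) ` marked_subsets (n - 1)"
  let ?J = "mon_ideal n ?G :: 'k cut_poly set"
  define b where "b l = (\<Sum>I\<in>{I. I \<noteq> {} \<and> I \<subseteq> {1..n - 1}}. \<Sum>i\<in>I. r_num n I i choose l)" for l
  obtain G where "linear_resolution n (n - 1 + 1) (aug_rank b) G ?J"
    using double_words_resolution[of n] unfolding b_def[abs_def, symmetric] by blast
  then have res: "resolves (poly_set n) (aug_rank b) G ?J"
    and hom: "hom_mat n (n - 1 + 1) (G 0)" "\<And>j. hom_mat n 1 (G (Suc j))"
    by (auto simp: linear_resolution_def)
  have min: "map_mat (\<lambda>p. lookup p 0) (G j) = 0\<^sub>m (aug_rank b j) (aug_rank b (Suc j))" for j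
  proof -
    obtain k where "k > 0" "hom_mat n k (G j)" using hom by (cases j) auto
    then show ?thesis
      using mats_in_carrier[OF poly.resolves_d[OF res, of j]]
      by (intro eq_matI) (auto simp: hom_mat_def intro: constant_coeff_homogeneous)
  qed
  have const: "lookup p 0 = 0" if p: "p \<in> ?J" for p
  proof (rule ccontr)
    assume "lookup p 0 \<noteq> 0"
    then have "0 \<in> keys p" by (simp add: in_keys_iff)
    then obtain x where x: "x \<in> marked_subsets (n - 1)" "mon_divides (double_word (n - 1) x) 0"
      using p by (auto simp: mon_ideal_def)
    have "lookup (double_word (n - 1) x) (Tv (snd x)) \<ge> 1"
      by (simp add: double_word_def lookup_add)
    then show False using x(2) by (auto simp: mon_divides_def dest!: spec[of _ "Tv (snd x)"])
  qed
  have betti: "betti n (ideal_module (poly_ring n) (L_ideal n :: 'k cut_poly set)) j = b j" for j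
    unfolding L_ideal_eq[OF assms]
    by (rule betti_of_minimal_resolution[OF _ zero_mon_ideal mon_ideal_add mon_ideal_mult const res min])
      (auto simp: mon_ideal_def)
  have "b 0 = (\<Sum>I\<in>Pow {1..n - 1}. card I)"
    unfolding b_def by (simp, rule sum.mono_neutral_left) auto
  also have "\<dots> = (n - 1) * 2 ^ (n - 2)"
    using sum_card_subsets[of "n - 1"] by (simp add: numeral_2_eq_2)
  finally show ?thesis using betti by (simp add: b_def)
qed

end
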